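(* Let $n\ge 1$, $a<b$, $\gamma,\alpha_0,\dots,\alpha_{n-1},\beta_0,\dots,\beta_{n-1}\in\mathbb{R}$, and let $L$ satisfy hypotheses (H1) and (H2) stated in the context. Suppose that $x\in C^{2n}([a,b],\mathbb{R})$ is a solution (minimizer or maximizer) of the problem of extremizing $z[x;b]$, where $z=z[x;\cdot]$ satisfies $$\dot z(t)=L\left(t,x(t),\dot x(t),\ldots,x^{(n)}(t),z(t)\right),\quad t\in[a,b],\qquad z(a)=\gamma,$$ among functions $x\in C^{2n}([a,b],\mathbb{R})$ subject to the boundary conditions $$x^{(i)}(a)=\alpha_i,\qquad x^{(i)}(b)=\beta_i,\qquad i=0,\ldots,n-1.$$ Then $x$ satisfies the generalized Euler--Lagrange equation $$\sum_{j=0}^{n}(-1)^j\frac{d^j}{dt^j}\left(\lambda(t)\,\frac{\partial L}{\partial x^{(j)}}\langle x,z\rangle_n(t)\right)=0,\qquad t\in[a,b],$$ where $$\lambda(t):=e^{-\int_a^t\frac{\partial L}{\partial z}\langle x,z\rangle_n(\theta)\,d\theta}.$$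
   Context: Notation: $x^{(0)}=x$; $\langle x,z\rangle_n(t):=\left(t,x(t),\dot x(t),\ldots,x^{(n)}(t),z(t)\right)$. The Lagrangian $L$ is a function of the $n+3$ real variables $(t,x,\dot x,\ldots,x^{(n)},z)$; $\frac{\partial L}{\partial x^{(j)}}$ and $\frac{\partial L}{\partial z}$ denote its partial derivatives with respect to the variables $x^{(j)}$ ($j=0,\ldots,n$) and $z$. An admissible trajectory is a function $x\in C^{2n}([a,b],\mathbb{R})$ that satisfies the imposed boundary conditions and for which the initial value problem $\dot z(t)=L\left(t,x(t),\dot x(t),\ldots,x^{(n)}(t),z(t)\right)$, $z(a)=\gamma$, has a solution $z$ on all of $[a,b]$; this solution is denoted $z(t)=z[x;t]$. A solution of the problem (an extremizer) is an admissible trajectory $x$ which minimizes $z[\,\cdot\,;b]$ over all admissible trajectories, or maximizes it over all admissible trajectories. Hypotheses on $L$: (H1) $L\in C^1(\mathbb{R}^{n+3},\mathbb{R})$. (H2) For any admissible trajectory $x$ (with $z=z[x;\cdot]$), the functions $t\mapsto\frac{\partial L}{\partial x^{(j)}}\langle x,z\rangle_n(t)$, $j=0,\ldots,n$, and $t\mapsto\frac{\partial L}{\partial z}\langle x,z\rangle_n(t)$ are differentiable up to order $n$ on $[a,b]$. *)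

theory Defs
  imports "HOL-Analysis.Analysis"
begin

text \<open>
  A function on the compact interval \<open>[a,b]\<close> is represented by a total function of type
  \<^typ>\<open>real \<Rightarrow> real\<close> of which only the values on \<open>{a..b}\<close> matter: all derivatives are taken
  within \<open>{a..b}\<close>, hence are one-sided at the end points.
\<close>

definition nderiv :: "real \<Rightarrow> real \<Rightarrow> nat \<Rightarrow> (real \<Rightarrow> real) \<Rightarrow> real \<Rightarrow> real" where
  "nderiv a b k f = ((\<lambda>g t. vector_derivative g (at t within {a..b})) ^^ k) f"

definition times_differentiable :: "real \<Rightarrow> real \<Rightarrow> nat \<Rightarrow> (real \<Rightarrow> real) \<Rightarrow> bool" where
  "times_differentiable a b k f \<longleftrightarrow> (\<forall>j<k. nderiv a b j f differentiable_on {a..b})"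

definition times_continuously_differentiable :: "real \<Rightarrow> real \<Rightarrow> nat \<Rightarrow> (real \<Rightarrow> real) \<Rightarrow> bool" where
  "times_continuously_differentiable a b k f \<longleftrightarrow>
     times_differentiable a b k f \<and> continuous_on {a..b} (nderiv a b k f)"

definition C1 :: "('v::euclidean_space \<Rightarrow> real) \<Rightarrow> bool" where
  "C1 f \<longleftrightarrow> (\<exists>f'. (\<forall>p. (f has_derivative blinfun_apply (f' p)) (at p)) \<and> continuous_on UNIV f')"

definition partial_deriv :: "('v::euclidean_space \<Rightarrow> real) \<Rightarrow> 'v \<Rightarrow> 'v \<Rightarrow> real" where
  "partial_deriv f v p = deriv (\<lambda>s. f (p + s *\<^sub>R v)) 0"

text \<open>
  The space of the variables \<open>(t, x, x\<^sup>(\<^sup>1\<^sup>), \<dots>, x\<^sup>(\<^sup>n\<^sup>), z)\<close> is \<open>\<real> \<times> \<real>\<^sup>m \<times> \<real>\<close> for an index type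
  \<open>'m\<close> with \<open>n + 1\<close> elements. A bijection \<open>idx\<close> from \<open>'m\<close> onto \<open>{0..n}\<close> tells which coordinate
  holds which derivative: coordinate \<open>i\<close> stands for the variable \<open>x\<^sup>(\<^sup>j\<^sup>)\<close> with \<open>j = idx i\<close>.
\<close>

type_synonym 'm lagrangian = "real \<times> (real ^ 'm) \<times> real \<Rightarrow> real"

definition jet ::
  "('m::finite \<Rightarrow> nat) \<Rightarrow> real \<Rightarrow> real \<Rightarrow> (real \<Rightarrow> real) \<Rightarrow> (real \<Rightarrow> real) \<Rightarrow> real \<Rightarrow> real \<times> (real ^ 'm) \<times> real"
  where "jet idx a b x z t = (t, (\<chi> i. nderiv a b (idx i) x t), z t)"

definition dL_dx :: "('m::finite \<Rightarrow> nat) \<Rightarrow> 'm lagrangian \<Rightarrow> nat \<Rightarrow> real \<times> (real ^ 'm) \<times> real \<Rightarrow> real"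
  where "dL_dx idx L j = partial_deriv L (0, axis (inv idx j) 1, 0)"

definition dL_dz :: "('m::finite) lagrangian \<Rightarrow> real \<times> (real ^ 'm) \<times> real \<Rightarrow> real"
  where "dL_dz L = partial_deriv L (0, 0, 1)"

definition solves_ivp ::
  "('m::finite \<Rightarrow> nat) \<Rightarrow> 'm lagrangian \<Rightarrow> real \<Rightarrow> real \<Rightarrow> real \<Rightarrow> (real \<Rightarrow> real) \<Rightarrow> (real \<Rightarrow> real) \<Rightarrow> bool"
  where "solves_ivp idx L a b \<gamma> x z \<longleftrightarrow>
    z a = \<gamma> \<and>
    (\<forall>t\<in>{a..b}. (z has_real_derivative L (jet idx a b x z t)) (at t within {a..b}))"

text \<open>
  For a Lagrangian of class \<open>C\<^sup>1\<close> and a trajectory of class \<open>C\<^sup>n\<close>, two solutions of the initial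
  value problem agree on \<open>{a..b}\<close>, so the choice below determines the values on \<open>{a..b}\<close>.
\<close>

definition z_of ::
  "('m::finite \<Rightarrow> nat) \<Rightarrow> 'm lagrangian \<Rightarrow> real \<Rightarrow> real \<Rightarrow> real \<Rightarrow> (real \<Rightarrow> real) \<Rightarrow> real \<Rightarrow> real"
  where "z_of idx L a b \<gamma> x = (SOME z. solves_ivp idx L a b \<gamma> x z)"

definition admissible ::
  "nat \<Rightarrow> ('m::finite \<Rightarrow> nat) \<Rightarrow> 'm lagrangian \<Rightarrow> real \<Rightarrow> real \<Rightarrow> real \<Rightarrow> (nat \<Rightarrow> real) \<Rightarrow> (nat \<Rightarrow> real)
     \<Rightarrow> (real \<Rightarrow> real) \<Rightarrow> bool"
  where "admissible n idx L a b \<gamma> \<alpha> \<beta> x \<longleftrightarrow>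
    times_continuously_differentiable a b (2 * n) x \<and>
    (\<forall>i<n. nderiv a b i x a = \<alpha> i \<and> nderiv a b i x b = \<beta> i) \<and>
    (\<exists>z. solves_ivp idx L a b \<gamma> x z)"

definition extremizer ::
  "nat \<Rightarrow> ('m::finite \<Rightarrow> nat) \<Rightarrow> 'm lagrangian \<Rightarrow> real \<Rightarrow> real \<Rightarrow> real \<Rightarrow> (nat \<Rightarrow> real) \<Rightarrow> (nat \<Rightarrow> real)
     \<Rightarrow> (real \<Rightarrow> real) \<Rightarrow> bool"
  where "extremizer n idx L a b \<gamma> \<alpha> \<beta> x \<longleftrightarrow>
    admissible n idx L a b \<gamma> \<alpha> \<beta> x \<and>
    ((\<forall>y. admissible n idx L a b \<gamma> \<alpha> \<beta> y \<longrightarrow> z_of idx L a b \<gamma> x b \<le> z_of idx L a b \<gamma> y b) \<or>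
     (\<forall>y. admissible n idx L a b \<gamma> \<alpha> \<beta> y \<longrightarrow> z_of idx L a b \<gamma> y b \<le> z_of idx L a b \<gamma> x b))"

definition regular_along_admissible ::
  "nat \<Rightarrow> ('m::finite \<Rightarrow> nat) \<Rightarrow> 'm lagrangian \<Rightarrow> real \<Rightarrow> real \<Rightarrow> real \<Rightarrow> (nat \<Rightarrow> real) \<Rightarrow> (nat \<Rightarrow> real) \<Rightarrow> bool"
  where "regular_along_admissible n idx L a b \<gamma> \<alpha> \<beta> \<longleftrightarrow>
    (\<forall>x. admissible n idx L a b \<gamma> \<alpha> \<beta> x \<longrightarrow>
      (\<forall>j\<in>{0..n}. times_differentiable a b n
                    (\<lambda>t. dL_dx idx L j (jet idx a b x (z_of idx L a b \<gamma> x) t))) \<and>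
      times_differentiable a b n (\<lambda>t. dL_dz L (jet idx a b x (z_of idx L a b \<gamma> x) t)))"

definition multiplier ::
  "('m::finite \<Rightarrow> nat) \<Rightarrow> 'm lagrangian \<Rightarrow> real \<Rightarrow> real \<Rightarrow> (real \<Rightarrow> real) \<Rightarrow> (real \<Rightarrow> real) \<Rightarrow> real \<Rightarrow> real"
  where "multiplier idx L a b x z t = exp (- integral {a..t} (\<lambda>\<theta>. dL_dz L (jet idx a b x z \<theta>)))"

text \<open>
  Since \<^const>\<open>vector_derivative\<close> is total, the existence of the derivatives in the
  Euler--Lagrange equation is required explicitly.
\<close>

definition euler_lagrange ::
  "nat \<Rightarrow> ('m::finite \<Rightarrow> nat) \<Rightarrow> 'm lagrangian \<Rightarrow> real \<Rightarrow> real \<Rightarrow> (real \<Rightarrow> real) \<Rightarrow> (real \<Rightarrow> real) \<Rightarrow> bool"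
  where "euler_lagrange n idx L a b x z \<longleftrightarrow>
    (\<forall>j\<in>{0..n}. times_differentiable a b j
                  (\<lambda>t. multiplier idx L a b x z t * dL_dx idx L j (jet idx a b x z t))) \<and>
    (\<forall>t\<in>{a..b}. (\<Sum>j=0..n. (-1) ^ j *
        nderiv a b j (\<lambda>t. multiplier idx L a b x z t * dL_dx idx L j (jet idx a b x z t)) t) = 0)"

end

theory Submission
  imports Defs
begin

text \<open>
  Perturb the extremizer \<open>x\<close> to \<open>x + \<epsilon> \<eta>\<close> with a polynomial \<open>\<eta>\<close> that vanishes to order \<open>n\<close> at both end
  points. For small \<open>\<epsilon>\<close> the perturbed initial value problem is still solvable on all of \<open>[a,b]\<close>, and the
  derivative of \<open>z(b)\<close> with respect to \<open>\<epsilon>\<close> solves a linear equation with integrating factor \<open>\<lambda>\<close>.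
  Extremality hence gives \<open>\<integral> \<lambda> \<Sum>\<^sub>j \<partial>L/\<partial>x\<^sup>(\<^sup>j\<^sup>) \<eta>\<^sup>(\<^sup>j\<^sup>) = 0\<close>. Integration by parts turns this into \<open>\<integral> E \<eta> = 0\<close>,
  where \<open>E\<close> is the left-hand side of the Euler--Lagrange equation. Since \<open>E\<close> is only known to be a
  derivative, not to be continuous, the conclusion \<open>E = 0\<close> is obtained by the method of du Bois-Reymond.
\<close>

section \<open>Iterated derivatives on an interval\<close>

lemma nderiv_0 [simp]: "nderiv a b 0 f = f"
  by (simp add: nderiv_def)

lemma nderiv_Suc: "nderiv a b (Suc k) f t = vector_derivative (nderiv a b k f) (at t within {a..b})"
  by (simp add: nderiv_def)

lemma vector_derivative_within_Icc:
  assumes "a < b" "t \<in> {a..b}" "(f has_real_derivative d) (at t within {a..b})"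
  shows "vector_derivative f (at t within {a..b}) = d"
  using assms by (intro vector_derivative_within_closed_interval)
    (auto simp: has_real_derivative_iff_has_vector_derivative)

lemma has_real_derivative_cong_on:
  assumes "x \<in> S" "\<And>y. y \<in> S \<Longrightarrow> g y = f y" "(f has_real_derivative d) (at x within S)"
  shows "(g has_real_derivative d) (at x within S)"
  using has_derivative_transform assms unfolding has_field_derivative_def by metis

lemma has_real_derivative_nderiv:
  assumes "a < b" "times_differentiable a b k f" "j < k" "t \<in> {a..b}"
  shows "(nderiv a b j f has_real_derivative nderiv a b (Suc j) f t) (at t within {a..b})"
  using assms
  by (auto simp: times_differentiable_def differentiable_on_def nderiv_Suc
        has_real_derivative_iff_has_vector_derivative vector_derivative_works)

text \<open>Derivatives within a nondegenerate interval are unique, so any explicit chain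
  \<open>g 0\<close>, \<open>g 1\<close>, ... of successive derivatives computes the total operator
  \<open>nderiv\<close> on \<open>{a..b}\<close>.\<close>

lemma nderiv_eqI:
  assumes "a < b" and g0: "\<And>t. t \<in> {a..b} \<Longrightarrow> f t = g 0 t"
    and g: "\<And>j t. j < k \<Longrightarrow> t \<in> {a..b} \<Longrightarrow>
      (g j has_real_derivative g (Suc j) t) (at t within {a..b})"
    and "j \<le> k" "t \<in> {a..b}"
  shows "nderiv a b j f t = g j t"
  using \<open>j \<le> k\<close> \<open>t \<in> {a..b}\<close>
proof (induction j arbitrary: t)
  case 0
  then show ?case by (simp add: g0)
next
  case (Suc j)
  have "(nderiv a b j f has_real_derivative g (Suc j) t) (at t within {a..b})"
    by (rule has_real_derivative_cong_on[OF _ _ g]) (use Suc in auto)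
  then show ?case
    using Suc \<open>a < b\<close> vector_derivative_within_Icc unfolding nderiv_Suc by blast
qed

text \<open>The working criterion for \<open>times_differentiable\<close>: sums, negatives and
  perturbed trajectories are handled by naming their chain of derivatives.\<close>

lemma times_differentiableI:
  assumes "a < b" and "\<And>t. t \<in> {a..b} \<Longrightarrow> f t = g 0 t"
    and g: "\<And>j t. j < k \<Longrightarrow> t \<in> {a..b} \<Longrightarrow>
      (g j has_real_derivative g (Suc j) t) (at t within {a..b})"
  shows "times_differentiable a b k f"
  unfolding times_differentiable_def differentiable_on_def
proof (intro allI impI ballI)
  fix j t assume j: "j < k" and t: "t \<in> {a..b}"
  have "(nderiv a b j f has_real_derivative g (Suc j) t) (at t within {a..b})"
    by (rule has_real_derivative_cong_on[OF _ _ g[OF j t]])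
       (use nderiv_eqI[of a b f g k j] assms j t in auto)
  then show "nderiv a b j f differentiable (at t within {a..b})"
    by (auto simp: has_field_derivative_def differentiable_def)
qed

lemma times_differentiable_Suc:
  assumes "a < b" and f: "\<And>t. t \<in> {a..b} \<Longrightarrow> (f has_real_derivative f' t) (at t within {a..b})"
    and f': "times_differentiable a b k f'"
  shows "times_differentiable a b (Suc k) f"
  by (rule times_differentiableI[of a b _ "\<lambda>j. case j of 0 \<Rightarrow> f | Suc i \<Rightarrow> nderiv a b i f'"])
     (use assms has_real_derivative_nderiv in \<open>auto split: nat.split\<close>)

lemma times_differentiable_nderiv_1:
  assumes "a < b" "times_differentiable a b (Suc k) f"
  shows "times_differentiable a b k (nderiv a b 1 f)"
  by (rule times_differentiableI[of a b _ "\<lambda>j. nderiv a b (Suc j) f"])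
     (use assms has_real_derivative_nderiv in auto)

lemma times_differentiable_mono:
  "times_differentiable a b k f \<Longrightarrow> j \<le> k \<Longrightarrow> times_differentiable a b j f"
  by (auto simp: times_differentiable_def)

lemma times_differentiable_add:
  assumes "a < b" "times_differentiable a b k f" "times_differentiable a b k g"
  shows "times_differentiable a b k (\<lambda>t. f t + g t)"
  by (rule times_differentiableI[of a b _ "\<lambda>j t. nderiv a b j f t + nderiv a b j g t"])
     (use assms in \<open>auto intro!: DERIV_add has_real_derivative_nderiv\<close>)

lemma times_differentiable_uminus:
  assumes "a < b" "times_differentiable a b k f"
  shows "times_differentiable a b k (\<lambda>t. - f t)"
  by (rule times_differentiableI[of a b _ "\<lambda>j t. - nderiv a b j f t"])
     (use assms in \<open>auto intro!: DERIV_minus has_real_derivative_nderiv\<close>)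

text \<open>Induction through the product rule replaces the Leibniz formula: the derivative is a sum
  of products whose factors admit one derivative fewer, which is why \<open>f\<close> and
  \<open>g\<close> vary in the induction.\<close>

lemma times_differentiable_mult:
  assumes "a < b" "times_differentiable a b k f" "times_differentiable a b k g"
  shows "times_differentiable a b k (\<lambda>t. f t * g t)"
  using assms(2,3)
proof (induction k arbitrary: f g)
  case 0
  then show ?case by (simp add: times_differentiable_def)
next
  case (Suc k)
  show ?case
  proof (rule times_differentiable_Suc[OF \<open>a < b\<close>])
    show "((\<lambda>t. f t * g t) has_real_derivative nderiv a b 1 f t * g t + nderiv a b 1 g t * f t)
        (at t within {a..b})" if "t \<in> {a..b}" for t
      using has_real_derivative_nderiv[OF \<open>a < b\<close> _ _ that, of "Suc k" _ 0] Suc.prems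
      by (auto intro!: DERIV_mult)
    show "times_differentiable a b k (\<lambda>t. nderiv a b 1 f t * g t + nderiv a b 1 g t * f t)"
      by (intro times_differentiable_add Suc.IH times_differentiable_nderiv_1 \<open>a < b\<close> Suc.prems)
         (use Suc.prems in \<open>auto elim: times_differentiable_mono\<close>)
  qed
qed

text \<open>Bootstrapping: an order of differentiability of \<open>m\<close> passes through the
  equation to its derivative, which gives \<open>m\<close> one order more. This supplies the
  smoothness of the multiplier.\<close>

lemma times_differentiable_linear_ode:
  assumes "a < b" and m: "\<And>t. t \<in> {a..b} \<Longrightarrow> (m has_real_derivative - (g t * m t)) (at t within {a..b})"
    and g: "times_differentiable a b k g"
  shows "times_differentiable a b k m"
  using g
proof (induction k)
  case 0
  then show ?case by (simp add: times_differentiable_def)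
next
  case (Suc k)
  then have *: "times_differentiable a b k g" by (auto elim: times_differentiable_mono)
  show ?case
    by (rule times_differentiable_Suc[OF \<open>a < b\<close> m])
       (auto intro!: times_differentiable_uminus times_differentiable_mult \<open>a < b\<close> * Suc.IH)
qed

lemma continuous_on_nderiv:
  assumes "times_differentiable a b k f" "j < k"
  shows "continuous_on {a..b} (nderiv a b j f)"
  using assms by (simp add: times_differentiable_def differentiable_imp_continuous_on)

section \<open>Polynomial test functions\<close>

text \<open>In the product rule for \<open>(X - c)^(m + 1) * q\<close> both summands keep the factor
  \<open>(X - c)^m\<close>.\<close>

lemma power_dvd_pderiv:
  fixes p :: "real poly"
  assumes "[:-c, 1:] ^ Suc m dvd p"
  shows "[:-c, 1:] ^ m dvd pderiv p"
proof -
  obtain q where "p = [:-c, 1:] ^ Suc m * q"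
    using assms by (rule dvdE)
  then have "pderiv p = [:-c, 1:] ^ Suc m * pderiv q
      + q * (smult (of_nat (Suc m)) ([:-c, 1:] ^ m) * pderiv [:-c, 1:])"
    by (simp only: pderiv_mult pderiv_power_Suc)
  then show ?thesis
    unfolding power_Suc
    by (simp only:) (intro dvd_add dvd_mult2 dvd_smult dvd_mult dvd_refl)
qed

text \<open>Each differentiation costs at most one in the multiplicity of the root \<open>c\<close>,
  so fewer than \<open>m\<close> of them leave a root.\<close>

lemma poly_pderiv_funpow_eq_0:
  fixes p :: "real poly"
  assumes "[:-c, 1:] ^ m dvd p" "i < m"
  shows "poly ((pderiv ^^ i) p) c = 0"
proof -
  have "[:-c, 1:] ^ (m - i) dvd (pderiv ^^ i) p" if "i \<le> m" for i
    using that
  proof (induction i)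
    case (Suc i)
    then have "m - i = Suc (m - Suc i)" by simp
    with Suc power_dvd_pderiv show ?case by auto
  qed (use assms in simp)
  then have "[:-c, 1:] ^ (m - i) dvd (pderiv ^^ i) p" using assms by simp
  moreover have "[:-c, 1:] dvd [:-c, 1:] ^ (m - i)" using assms(2) by (simp add: dvd_power)
  ultimately have "[:-c, 1:] dvd (pderiv ^^ i) p" by (rule dvd_trans[rotated])
  then show ?thesis by (simp add: poly_eq_0_iff_dvd)
qed

lemma poly_antiderivative:
  fixes p :: "real poly"
  shows "\<exists>q. pderiv q = p \<and> poly q c = 0"
proof -
  have "\<exists>q. pderiv q = p"
  proof
    \<comment> \<open>Termwise integration: each coefficient is divided by its degree plus one and
      moved one degree up.\<close>
    have "pderiv (monom (coeff p i / real (Suc i)) (Suc i)) = monom (coeff p i) i" for i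
      by (simp add: pderiv_monom del: of_nat_Suc)
    then show "pderiv (\<Sum>i\<le>degree p. monom (coeff p i / real (Suc i)) (Suc i)) = p"
      by (simp only: higher_pderiv_sum[of 1, unfolded One_nat_def funpow.simps o_id id_o] poly_as_sum_of_monoms)
  qed
  then obtain q where "pderiv q = p" by blast
  then have "pderiv (q - [:poly q c:]) = p \<and> poly (q - [:poly q c:]) c = 0"
    by (simp add: pderiv_diff pderiv_pCons)
  then show ?thesis by blast
qed

section \<open>Orthogonality to polynomials and the du Bois-Reymond lemma\<close>

lemma real_polynomial_function_imp_poly:
  assumes "real_polynomial_function g"
  shows "\<exists>p. g = poly p"
proof -
  obtain c n where "g = (\<lambda>x. \<Sum>i\<le>n. c i * x ^ i)"
    using assms real_polynomial_function_iff_sum by blast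
  then have "g = poly (\<Sum>i\<le>n. monom (c i) i)"
    by (auto simp: poly_sum poly_monom)
  then show ?thesis ..
qed

text \<open>For a polynomial \<open>p\<close> within \<open>e\<close> of \<open>f\<close>,
  orthogonality turns the integral of \<open>f^2\<close> into that of \<open>f * (f - p)\<close>,
  which is at most \<open>e\<close> times the integral of the absolute value of \<open>f\<close>. As
  \<open>e\<close> is arbitrary, the integral of \<open>f^2\<close> vanishes.\<close>

lemma orthogonal_to_polynomials_imp_zero:
  fixes f :: "real \<Rightarrow> real"
  assumes "a < b" and f: "continuous_on {a..b} f"
    and orth: "\<And>p. integral {a..b} (\<lambda>t. f t * poly p t) = 0"
    and "t \<in> {a..b}"
  shows "f t = 0"
proof -
  define M where "M = integral {a..b} (\<lambda>t. \<bar>f t\<bar>)"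
  have "M \<ge> 0" unfolding M_def by (rule integral_nonneg) (auto intro!: integrable_continuous_interval continuous_intros f)
  have le: "integral {a..b} (\<lambda>t. f t * f t) \<le> e * M" if e: "e > 0" for e
  proof -
    obtain g where g: "real_polynomial_function g" "\<And>x. x \<in> {a..b} \<Longrightarrow> \<bar>f x - g x\<bar> < e"
      by (rule Stone_Weierstrass_real_polynomial_function[OF compact_Icc f e]) blast
    then obtain p where p: "g = poly p" using real_polynomial_function_imp_poly by blast
    have "integral {a..b} (\<lambda>t. f t * f t)
        = integral {a..b} (\<lambda>t. f t * f t) - integral {a..b} (\<lambda>t. f t * poly p t)"
      by (simp add: orth)
    also have "\<dots> = integral {a..b} (\<lambda>t. f t * f t - f t * poly p t)"
      by (intro integral_diff[symmetric] integrable_continuous_interval continuous_intros f)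
    also have "\<dots> \<le> integral {a..b} (\<lambda>t. e * \<bar>f t\<bar>)"
    proof (intro integral_le integrable_continuous_interval continuous_intros f)
      fix t assume t: "t \<in> {a..b}"
      have "f t * f t - f t * poly p t \<le> \<bar>f t - poly p t\<bar> * \<bar>f t\<bar>"
        by (simp add: right_diff_distrib[symmetric] abs_mult[symmetric] mult.commute)
      also have "\<dots> \<le> e * \<bar>f t\<bar>"
        using g(2)[OF t] p by (intro mult_right_mono) auto
      finally show "f t * f t - f t * poly p t \<le> e * \<bar>f t\<bar>" .
    qed
    finally show ?thesis by (simp add: M_def)
  qed
  have "integral {a..b} (\<lambda>t. f t * f t) \<le> 0"
  proof (rule field_le_epsilon)
    fix e :: real assume "e > 0"
    \<comment> \<open>The denominator \<open>M + 1\<close> covers the case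
      \<open>M = 0\<close>.\<close>
    have "integral {a..b} (\<lambda>t. f t * f t) \<le> e / (M + 1) * M"
      using \<open>M \<ge> 0\<close> \<open>e > 0\<close> by (intro le) auto
    also have "\<dots> \<le> e" using \<open>M \<ge> 0\<close> \<open>e > 0\<close> by (simp add: field_simps)
    finally show "integral {a..b} (\<lambda>t. f t * f t) \<le> 0 + e" by simp
  qed
  moreover have "integral {a..b} (\<lambda>t. f t * f t) \<ge> 0"
    by (rule integral_nonneg) (auto intro!: integrable_continuous_interval continuous_intros f)
  ultimately have "integral {a..b} (\<lambda>t. f t * f t) = 0" by simp
  then have "\<forall>t\<in>{a..b}. f t * f t = 0"
    by (subst (asm) integral_eq_0_iff) (auto intro!: continuous_intros f \<open>a < b\<close>)
  then show ?thesis using \<open>t \<in> {a..b}\<close> by simp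
qed

text \<open>
  The function \<open>E\<close> need not be continuous, so bump functions do not apply directly; the argument of
  du Bois-Reymond shows that its antiderivative \<open>G\<close> is constant. The test functions are primitives
  of \<open>w (p - c)\<close>, where \<open>w\<close> vanishes to high order at the end points and \<open>c\<close> makes the integral zero.
\<close>

lemma du_Bois_Reymond:
  fixes E G :: "real \<Rightarrow> real"
  assumes "a < b"
    and G: "\<And>t. t \<in> {a..b} \<Longrightarrow> (G has_real_derivative E t) (at t within {a..b})"
    and orth: "\<And>\<eta> :: real poly. (\<And>i. i < n \<Longrightarrow> poly ((pderiv ^^ i) \<eta>) a = 0 \<and> poly ((pderiv ^^ i) \<eta>) b = 0)
      \<Longrightarrow> ((\<lambda>t. E t * poly \<eta> t) has_integral 0) {a..b}"
    and "t \<in> {a..b}"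
  shows "E t = 0"
proof -
  have contG: "continuous_on {a..b} G"
    using G by (rule DERIV_continuous_on)
  \<comment> \<open>Even exponents make \<open>w\<close> nonnegative, and it has no zero strictly
    between \<open>a\<close> and \<open>b\<close>; the order \<open>2 * n\<close> at the end points
    covers the boundary conditions on the test functions.\<close>
  define w :: "real poly" where "w = [:-a, 1:] ^ (2 * n) * [:-b, 1:] ^ (2 * n)"
  have w_nonneg: "poly w t \<ge> 0" for t
    by (simp add: w_def poly_power)
  have w_nz: "poly w t \<noteq> 0" if "a < t" "t < b" for t
    using that by (simp add: w_def poly_power)
  define I where "I = integral {a..b} (poly w)"
  have "I \<noteq> 0"
  proof
    assume "I = 0"
    then have "\<forall>t\<in>{a..b}. poly w t = 0"
      unfolding I_def
      by (subst (asm) integral_eq_0_iff) (auto intro!: continuous_intros w_nonneg \<open>a < b\<close>)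
    then show False using w_nz[of "(a + b) / 2"] \<open>a < b\<close> by auto
  qed
  \<comment> \<open>The mean of \<open>G\<close> with weight \<open>w\<close>, which will turn out
    to be the constant value of \<open>G\<close>.\<close>
  define c0 where "c0 = integral {a..b} (\<lambda>t. G t * poly w t) / I"
  have zero: "integral {a..b} (\<lambda>t. ((G t - c0) * poly w t) * poly p t) = 0" for p
  proof -
    \<comment> \<open>Subtracting \<open>J / I\<close> from \<open>p\<close> makes the integral of
      \<open>q\<close> zero, so the antiderivative of \<open>q\<close> that vanishes at
      \<open>a\<close> vanishes at \<open>b\<close> too.\<close>
    define J where "J = integral {a..b} (\<lambda>t. poly w t * poly p t)"
    define q where "q = w * (p - [:J / I:])"
    obtain \<eta> where \<eta>: "pderiv \<eta> = q" "poly \<eta> a = 0" using poly_antiderivative by blast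
    have qint: "(poly q has_integral (poly \<eta> b - poly \<eta> a)) {a..b}"
      by (rule fundamental_theorem_of_calculus)
         (use \<open>a < b\<close> in \<open>auto simp flip: \<eta>(1) has_real_derivative_iff_has_vector_derivative
            intro!: has_field_derivative_at_within poly_DERIV\<close>)
    have "integral {a..b} (poly q)
        = integral {a..b} (\<lambda>t. poly w t * poly p t - J / I * poly w t)"
      by (rule integral_cong) (simp add: q_def algebra_simps)
    also have "\<dots> = J - J / I * I"
      using \<open>I \<noteq> 0\<close> by (subst integral_diff) (auto simp: J_def I_def intro!: integrable_continuous_interval continuous_intros)
    finally have "integral {a..b} (poly q) = 0" using \<open>I \<noteq> 0\<close> by simp
    then have \<eta>b: "poly \<eta> b = 0" using integral_unique[OF qint] \<eta>(2) by simp
    have vanish: "poly ((pderiv ^^ i) \<eta>) a = 0 \<and> poly ((pderiv ^^ i) \<eta>) b = 0" if "i < n" for i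
    proof (cases i)
      case 0
      then show ?thesis using \<eta> \<eta>b by simp
    next
      case (Suc k)
      \<comment> \<open>The derivative of \<open>\<eta>\<close> of order \<open>k + 1\<close> is
        that of \<open>q\<close> of order \<open>k\<close>, and \<open>q\<close> inherits the zeros
        of \<open>w\<close>.\<close>
      have "[:-a, 1:] ^ (2 * n) dvd q" "[:-b, 1:] ^ (2 * n) dvd q"
        by (auto simp: q_def w_def)
      then show ?thesis using Suc \<eta>(1) that poly_pderiv_funpow_eq_0[of _ "2 * n" q k]
        by (simp add: funpow_swap1)
    qed
    \<comment> \<open>The gauge integral allows the fundamental theorem for
      \<open>G * \<eta>\<close> although its derivative may be discontinuous. The boundary terms
      vanish and \<open>orth\<close> removes the part with \<open>E\<close>.\<close>
    have "((\<lambda>t. E t * poly \<eta> t + poly q t * G t) has_integral (G b * poly \<eta> b - G a * poly \<eta> a)) {a..b}"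
      by (rule fundamental_theorem_of_calculus)
         (use \<open>a < b\<close> in \<open>auto simp flip: has_real_derivative_iff_has_vector_derivative \<eta>(1)
            intro!: DERIV_mult G has_field_derivative_at_within[OF poly_DERIV]\<close>)
    from has_integral_diff[OF this orth[OF vanish]]
    have "integral {a..b} (\<lambda>t. poly q t * G t) = 0"
      using \<eta>b \<eta>(2) by (simp add: integral_unique)
    \<comment> \<open>Writing \<open>G\<close> as \<open>(G - c0) + c0\<close> in the term with
      \<open>p\<close> isolates the wanted integral; the other two contribute
      \<open>- J / I * (c0 * I)\<close> and \<open>c0 * J\<close>, which cancel.\<close>
    moreover have "((\<lambda>t. ((G t - c0) * poly w t) * poly p t
        - J / I * (G t * poly w t) + c0 * (poly w t * poly p t)) has_integral
        integral {a..b} (\<lambda>t. ((G t - c0) * poly w t) * poly p t) - J / I * (c0 * I) + c0 * J) {a..b}"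
    proof (intro has_integral_add has_integral_diff has_integral_mult_right)
      have "c0 * I = integral {a..b} (\<lambda>t. G t * poly w t)" using \<open>I \<noteq> 0\<close> by (simp add: c0_def)
      then show "((\<lambda>t. G t * poly w t) has_integral c0 * I) {a..b}"
        by (simp only:) (intro integrable_integral integrable_continuous_interval continuous_intros contG)
    qed (unfold J_def, (intro integrable_integral integrable_continuous_interval continuous_intros contG)+)
    moreover have "(\<lambda>t. poly q t * G t) = (\<lambda>t. ((G t - c0) * poly w t) * poly p t
        - J / I * (G t * poly w t) + c0 * (poly w t * poly p t))"
      by (rule ext) (simp add: q_def algebra_simps)
    ultimately show ?thesis using \<open>I \<noteq> 0\<close> by (simp add: integral_unique)
  qed
  have Gw: "(G s - c0) * poly w s = 0" if "s \<in> {a..b}" for s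
    by (rule orthogonal_to_polynomials_imp_zero[OF \<open>a < b\<close> _ zero that])
       (intro continuous_intros contG)
  have interior: "G s = c0" if "s \<in> {a<..<b}" for s
    using Gw[of s] w_nz[of s] that by auto
  \<comment> \<open>Since \<open>w\<close> may vanish at the end points, the value there comes from
    continuity of \<open>G\<close>.\<close>
  have Gc: "G s = c0" if "s \<in> {a..b}" for s
    by (rule continuous_constant_on_closure[of "{a<..<b}", OF _ interior])
       (use contG that \<open>a < b\<close> in auto)
  have "(G has_real_derivative 0) (at t within {a..b})"
    by (rule has_real_derivative_cong_on[OF \<open>t \<in> {a..b}\<close> _ DERIV_const[of c0]]) (rule Gc)
  then show ?thesis
    using vector_derivative_within_Icc[OF \<open>a < b\<close> \<open>t \<in> {a..b}\<close>, of G 0]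
      vector_derivative_within_Icc[OF \<open>a < b\<close> \<open>t \<in> {a..b}\<close> G[OF \<open>t \<in> {a..b}\<close>]] by simp
qed

section \<open>Initial value problems\<close>

lemma has_real_derivative_bound:
  fixes f :: "real \<Rightarrow> real"
  assumes "a \<le> b" and f: "\<And>t. t \<in> {a..b} \<Longrightarrow> (f has_real_derivative f' t) (at t within {a..b})"
    and "\<And>t. t \<in> {a..b} \<Longrightarrow> \<bar>f' t\<bar> \<le> B"
  shows "\<bar>f b - f a\<bar> \<le> B * (b - a)"
proof -
  have "norm (f b - f a) \<le> B * norm (b - a)"
    by (rule field_differentiable_bound[OF _ f]) (use assms in auto)
  then show ?thesis using assms by simp
qed

text \<open>
  The substitution \<open>u(t) = e\<^bsup>K(t - a)\<^esup> v(t)\<close> with \<open>K = 2M + 1\<close> makes the Picard operator a contraction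
  with factor \<open>1/2\<close> for the supremum norm on all of \<open>{a..b}\<close>; it also gives the bound on \<open>u\<close>.
\<close>

lemma Lipschitz_ivp_solution:
  fixes G :: "real \<Rightarrow> real \<Rightarrow> real"
  assumes "a \<le> b" and "0 \<le> M" and "0 \<le> C"
    and contG: "continuous_on ({a..b} \<times> UNIV) (\<lambda>(t, u). G t u)"
    and lip: "\<And>t u v. t \<in> {a..b} \<Longrightarrow> \<bar>G t u - G t v\<bar> \<le> M * \<bar>u - v\<bar>"
    and G0: "\<And>t. t \<in> {a..b} \<Longrightarrow> \<bar>G t 0\<bar> \<le> C"
  shows "\<exists>u. u a = 0 \<and>
    (\<forall>t\<in>{a..b}. (u has_real_derivative G t (u t)) (at t within {a..b}) \<and>
      \<bar>u t\<bar> \<le> 2 * exp ((2 * M + 1) * (b - a)) * (b - a) * C)"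
proof -
  define K where "K = 2 * M + 1"
  have "K > 0" "K \<ge> 2 * M" using \<open>0 \<le> M\<close> by (auto simp: K_def)
  \<comment> \<open>\<open>H v\<close> is the right-hand side after the substitution, and
    \<open>S\<close> is the Picard operator rewritten for \<open>v\<close>.\<close>
  define H where "H v s = G s (exp (K * (s - a)) * v s)" for v :: "real \<Rightarrow> real" and s
  define S where "S v t = exp (- K * (t - a)) * integral {a..t} (H v)" for v :: "real \<Rightarrow> real" and t
  have contH: "continuous_on {a..b} (H v)" if "continuous_on {a..b} v" for v
  proof -
    have "continuous_on {a..b} ((\<lambda>(t, u). G t u) \<circ> (\<lambda>s. (s, exp (K * (s - a)) * v s)))"
      by (rule continuous_on_compose[OF _ continuous_on_subset[OF contG]])
         (auto intro!: continuous_intros that)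
    then show ?thesis by (simp add: o_def H_def[abs_def])
  qed
  have derI: "((\<lambda>t. integral {a..t} (H v)) has_real_derivative H v t) (at t within {a..b})"
    if "continuous_on {a..b} v" "t \<in> {a..b}" for v t
    using integral_has_real_derivative contH that by blast
  have contS: "continuous_on (cbox a b) (S v)" if "continuous_on {a..b} v" for v
    unfolding S_def[abs_def] box_real
    by (intro continuous_intros DERIV_continuous_on[OF derI[OF that]])
  have S_diff: "\<bar>S v t - S w t\<bar> \<le> 1 / 2 * d"
    if v: "continuous_on {a..b} v" and w: "continuous_on {a..b} w" and t: "t \<in> {a..b}"
      and d: "\<And>s. s \<in> {a..b} \<Longrightarrow> \<bar>v s - w s\<bar> \<le> d" for v w t d
  proof -
    have "0 \<le> d" using d[OF t] by linarith
    have sub: "continuous_on {a..t} (H v)" "continuous_on {a..t} (H w)"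
      by (rule continuous_on_subset[OF contH]; use v w t in simp)+
    have "integral {a..t} (H v) - integral {a..t} (H w) = integral {a..t} (\<lambda>s. H v s - H w s)"
      by (intro integral_diff[symmetric] integrable_continuous_interval sub)
    \<comment> \<open>With \<open>M \<le> K / 2\<close> the bound has the antiderivative
      \<open>exp (K * (s - a)) * (d / 2)\<close>. The weight in \<open>S\<close> then cancels the
      exponential and leaves the factor \<open>1 / 2\<close>, whatever the length of the
      interval.\<close>
    also have "norm \<dots> \<le> integral {a..t} (\<lambda>s. K / 2 * d * exp (K * (s - a)))"
    proof (rule integral_norm_bound_integral)
      fix s assume "s \<in> {a..t}"
      then have s: "s \<in> {a..b}" using t by auto
      have "norm (H v s - H w s) \<le> M * \<bar>exp (K * (s - a)) * v s - exp (K * (s - a)) * w s\<bar>"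
        using lip[OF s] by (simp add: H_def)
      also have "\<dots> = M * (exp (K * (s - a)) * \<bar>v s - w s\<bar>)"
        by (simp add: right_diff_distrib[symmetric] abs_mult)
      also have "\<dots> \<le> K / 2 * (exp (K * (s - a)) * d)"
        using d[OF s] \<open>K \<ge> 2 * M\<close> \<open>0 \<le> M\<close> by (intro mult_mono) auto
      finally show "norm (H v s - H w s) \<le> K / 2 * d * exp (K * (s - a))" by (simp add: mult_ac)
    qed (intro integrable_continuous_interval continuous_intros sub)+
    also have "\<dots> = exp (K * (t - a)) * (d / 2) - exp (K * (a - a)) * (d / 2)"
    proof (rule integral_unique, rule fundamental_theorem_of_calculus)
      show "((\<lambda>s. exp (K * (s - a)) * (d / 2)) has_vector_derivative K / 2 * d * exp (K * (s - a)))
          (at s within {a..t})" for s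
        by (simp flip: has_real_derivative_iff_has_vector_derivative)
           (auto intro!: derivative_eq_intros)
    qed (use t in auto)
    finally have *: "\<bar>integral {a..t} (H v) - integral {a..t} (H w)\<bar> \<le> exp (K * (t - a)) * (d / 2)"
      using \<open>0 \<le> d\<close> by simp
    have "\<bar>S v t - S w t\<bar> = exp (- K * (t - a)) * \<bar>integral {a..t} (H v) - integral {a..t} (H w)\<bar>"
      by (simp add: S_def right_diff_distrib[symmetric] abs_mult)
    also have "\<dots> \<le> exp (- K * (t - a)) * (exp (K * (t - a)) * (d / 2))"
      by (intro mult_left_mono *) auto
    also have "\<dots> = d / 2" by (simp add: mult.assoc[symmetric] exp_add[symmetric])
    finally show ?thesis by simp
  qed
  have S0: "\<bar>S (\<lambda>_. 0) t\<bar> \<le> (b - a) * C" if t: "t \<in> {a..b}" for t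
  proof -
    have H0: "continuous_on {a..t} (H (\<lambda>_. 0))"
      by (rule continuous_on_subset[OF contH]) (use t in auto)
    have "norm (integral {a..t} (H (\<lambda>_. 0))) \<le> C * (t - a)"
      by (rule integral_bound[OF _ H0]) (use t G0 in \<open>auto simp: H_def\<close>)
    also have "\<dots> \<le> C * (b - a)" using t \<open>0 \<le> C\<close> by (intro mult_left_mono) auto
    finally have "exp (- K * (t - a)) * \<bar>integral {a..t} (H (\<lambda>_. 0))\<bar> \<le> 1 * (C * (b - a))"
      using t \<open>K > 0\<close> by (intro mult_mono) auto
    then show ?thesis by (simp add: S_def abs_mult mult_ac)
  qed
  \<comment> \<open>Clamping the time extends \<open>S v\<close> to a bounded continuous function on
    the line, so that the Banach fixed point theorem applies in a complete space.\<close>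
  have "\<exists>g :: real \<Rightarrow>\<^sub>C real. \<forall>t. g t = S v (clamp a b t)" for v :: "real \<Rightarrow>\<^sub>C real"
    by (rule continuous_on_cbox_bcontfunE[OF contS[of v]]) auto
  then have "\<exists>T :: (real \<Rightarrow>\<^sub>C real) \<Rightarrow> (real \<Rightarrow>\<^sub>C real). \<forall>v t. apply_bcontfun (T v) t = S (apply_bcontfun v) (clamp a b t)"
    by (intro choice) blast
  then obtain T :: "(real \<Rightarrow>\<^sub>C real) \<Rightarrow> (real \<Rightarrow>\<^sub>C real)"
    where T: "\<And>v t. apply_bcontfun (T v) t = S (apply_bcontfun v) (clamp a b t)" by blast
  have clamp: "clamp a b t \<in> {a..b}" for t
    using clamp_in_interval[of a b t] \<open>a \<le> b\<close> by simp
  have "dist (T v) (T w) \<le> 1 / 2 * dist v w" for v w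
  proof (rule dist_bound)
    fix t
    show "dist (T v t) (T w t) \<le> 1 / 2 * dist v w"
      unfolding T dist_real_def
      by (rule S_diff) (use dist_bounded[of v _ w] clamp in \<open>auto simp: dist_real_def\<close>)
  qed
  then obtain v where v: "T v = v"
    using banach_fix_type[of "1 / 2" T] by auto
  have vS: "v t = S v t" if "t \<in> {a..b}" for t
    using T[of v t] v clamp_cancel_cbox[of t a b] that by simp
  \<comment> \<open>Comparing \<open>v = S v\<close> with \<open>S 0\<close> bounds
    \<open>norm v\<close> by half of itself plus \<open>(b - a) * C\<close>; the half is absorbed on
    the left.\<close>
  have vb: "\<bar>v t\<bar> \<le> 2 * ((b - a) * C)" for t
  proof -
    have "\<bar>v t\<bar> \<le> 1 / 2 * norm v + (b - a) * C" for t
    proof -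
      have "\<bar>S v (clamp a b t) - S (\<lambda>_. 0) (clamp a b t)\<bar> \<le> 1 / 2 * norm v"
        by (rule S_diff) (use clamp norm_bounded[of v] in auto)
      moreover have "v t = S v (clamp a b t)" using T[of v t] v by simp
      ultimately show ?thesis using S0[OF clamp[of t]] by linarith
    qed
    then have "norm v \<le> 1 / 2 * norm v + (b - a) * C"
      by (intro norm_bound) auto
    then have "norm v \<le> 2 * ((b - a) * C)" by simp
    with norm_bounded[of v t] show ?thesis by simp
  qed
  define u where "u t = exp (K * (t - a)) * v t" for t
  have u: "u t = integral {a..t} (H v)" if "t \<in> {a..b}" for t
    using vS[OF that] by (simp add: u_def S_def mult.assoc[symmetric] exp_add[symmetric])
  have "(u has_real_derivative G t (u t)) (at t within {a..b})" if t: "t \<in> {a..b}" for t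
    using has_real_derivative_cong_on[OF t u derI[OF _ t]]
    by (simp add: H_def flip: u_def)
  moreover have "u a = 0" using u[of a] \<open>a \<le> b\<close> by simp
  moreover have "\<bar>u t\<bar> \<le> 2 * exp (K * (b - a)) * (b - a) * C" if "t \<in> {a..b}" for t
  proof -
    have "\<bar>u t\<bar> = exp (K * (t - a)) * \<bar>v t\<bar>" by (simp add: u_def abs_mult)
    also have "\<dots> \<le> exp (K * (b - a)) * (2 * ((b - a) * C))"
      using vb[of t] that \<open>K > 0\<close> by (intro mult_mono) auto
    finally show ?thesis by (simp add: algebra_simps)
  qed
  ultimately show ?thesis unfolding K_def by blast
qed

text \<open>The derivative is bounded on the compact ball, and convexity lets the mean value
  inequality act between any two of its points.\<close>

lemma C1_Lipschitz_on_cball: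
  fixes L :: "'v::euclidean_space \<Rightarrow> real"
  assumes L: "\<And>q. (L has_derivative blinfun_apply (L' q)) (at q)" and "continuous_on UNIV L'"
  shows "\<exists>N\<ge>0. \<forall>p\<in>cball 0 R. \<forall>q\<in>cball 0 R. \<bar>L p - L q\<bar> \<le> N * norm (p - q)"
proof -
  have "continuous_on (cball 0 R) L'" using assms(2) continuous_on_subset by blast
  then have "bounded (L' ` cball 0 R)"
    by (intro compact_imp_bounded compact_continuous_image) auto
  then obtain N where N: "N > 0" "\<And>q. q \<in> cball 0 R \<Longrightarrow> norm (L' q) \<le> N"
    by (auto simp: bounded_pos)
  have "norm (L p - L q) \<le> N * norm (p - q)" if "p \<in> cball 0 R" "q \<in> cball 0 R" for p q
    by (rule differentiable_bound[OF convex_cball has_derivative_at_withinI[OF L] _ that])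
       (use N in \<open>simp add: norm_blinfun.rep_eq\<close>)
  then show ?thesis using \<open>N > 0\<close> by (intro exI[of _ N]) auto
qed

text \<open>Gronwall argument: the squared difference of the solutions, damped by
  \<open>exp (- (2 * K) * (t - a))\<close>, cannot increase and starts at zero. The curve
  \<open>p\<close> carries the given arguments of \<open>L\<close>, and \<open>e\<close> is the
  direction of the unknown.\<close>

lemma ivp_unique:
  fixes L :: "'v::euclidean_space \<Rightarrow> real"
  assumes "a < b" and L: "\<And>q. (L has_derivative blinfun_apply (L' q)) (at q)" "continuous_on UNIV L'"
    and p: "continuous_on {a..b} p"
    and y: "\<And>t. t \<in> {a..b} \<Longrightarrow> (y has_real_derivative L (p t + y t *\<^sub>R e)) (at t within {a..b})"
    and z: "\<And>t. t \<in> {a..b} \<Longrightarrow> (z has_real_derivative L (p t + z t *\<^sub>R e)) (at t within {a..b})"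
    and "y a = z a"
  shows "y b = z b"
proof -
  have cont: "continuous_on {a..b} y" "continuous_on {a..b} z"
    by (rule DERIV_continuous_on[OF y], assumption, rule DERIV_continuous_on[OF z])
  \<comment> \<open>Both solution curves have compact image, so one ball contains them and one
    Lipschitz constant serves.\<close>
  have "bounded ((\<lambda>t. p t + y t *\<^sub>R e) ` {a..b} \<union> (\<lambda>t. p t + z t *\<^sub>R e) ` {a..b})"
    by (intro compact_imp_bounded compact_Un compact_continuous_image continuous_intros p cont compact_Icc)
  then obtain R where "\<And>q. q \<in> (\<lambda>t. p t + y t *\<^sub>R e) ` {a..b} \<union> (\<lambda>t. p t + z t *\<^sub>R e) ` {a..b} \<Longrightarrow> norm q \<le> R"
    unfolding bounded_iff by blast
  then have R: "p t + y t *\<^sub>R e \<in> cball 0 R \<and> p t + z t *\<^sub>R e \<in> cball 0 R" if "t \<in> {a..b}" for t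
    unfolding mem_cball_0 using that by blast
  obtain N where "N \<ge> 0" and N: "\<And>p q. p \<in> cball 0 R \<Longrightarrow> q \<in> cball 0 R \<Longrightarrow> \<bar>L p - L q\<bar> \<le> N * norm (p - q)"
    using C1_Lipschitz_on_cball[OF L, of R] by blast
  define K where "K = N * norm e"
  define f where "f t = (y t - z t)\<^sup>2 * exp (- (2 * K) * (t - a))" for t
  define D where "D t = L (p t + y t *\<^sub>R e) - L (p t + z t *\<^sub>R e)" for t
  have D: "(y t - z t) * D t \<le> K * (y t - z t)\<^sup>2" if "t \<in> {a..b}" for t
  proof -
    have "\<bar>D t\<bar> \<le> K * \<bar>y t - z t\<bar>"
      using N[of "p t + y t *\<^sub>R e" "p t + z t *\<^sub>R e"] R[OF that]
      by (simp add: D_def K_def scaleR_left_diff_distrib[symmetric] mult_ac)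
    then have "\<bar>y t - z t\<bar> * \<bar>D t\<bar> \<le> \<bar>y t - z t\<bar> * (K * \<bar>y t - z t\<bar>)"
      by (intro mult_left_mono) auto
    also have "\<dots> = K * (y t - z t)\<^sup>2"
      by (simp add: power2_eq_square mult_ac flip: abs_mult)
    finally show ?thesis by (simp flip: abs_mult)
  qed
  have f': "(f has_real_derivative
      2 * ((y t - z t) * D t - K * (y t - z t)\<^sup>2) * exp (- (2 * K) * (t - a))) (at t within {a..b})"
    if "t \<in> {a..b}" for t
    unfolding f_def[abs_def] using y[OF that] z[OF that]
    by (auto intro!: derivative_eq_intros simp: D_def power2_eq_square algebra_simps)
  have "f b \<le> f a"
  proof (rule DERIV_nonpos_imp_decreasing_open[of a b f])
    show "continuous_on {a..b} f" using f' by (rule DERIV_continuous_on)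
    fix t assume "a < t" "t < b"
    then show "\<exists>d. (f has_real_derivative d) (at t) \<and> d \<le> 0"
      using f'[of t] D[of t]
      by (intro exI[of _ "2 * ((y t - z t) * D t - K * (y t - z t)\<^sup>2) * exp (- (2 * K) * (t - a))"])
         (auto simp: at_within_Icc_at mult_le_0_iff)
  qed (use \<open>a < b\<close> in simp)
  then have "(y b - z b)\<^sup>2 * exp (- (2 * K) * (b - a)) \<le> 0"
    using \<open>y a = z a\<close> by (simp add: f_def)
  then show ?thesis by (simp add: mult_le_0_iff)
qed

section \<open>Differentiating the terminal value in the perturbation parameter\<close>

text \<open>
  Clamping the unknown to \<open>[-1,1]\<close> makes the equation for \<open>u = z\<^sub>\<epsilon> - z\<^sub>0\<close> globally Lipschitz; the a priori
  bound \<open>\<bar>u\<bar> \<le> Q \<bar>\<epsilon>\<bar>\<close> then shows that the clamp is inactive for small \<open>\<epsilon>\<close>. The function \<open>m\<close> is an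
  integrating factor for the linearised equation.
\<close>

lemma first_variation:
  fixes L :: "'v::euclidean_space \<Rightarrow> real"
  assumes "a < b" and L: "\<And>q. (L has_derivative blinfun_apply (L' q)) (at q)" and L': "continuous_on UNIV L'"
    and p: "continuous_on {a..b} p" and h: "continuous_on {a..b} h"
    and m: "\<And>t. t \<in> {a..b} \<Longrightarrow> (m has_real_derivative - (L' (p t) e * m t)) (at t within {a..b})"
    and m_pos: "m b > 0"
    and W: "\<And>t. t \<in> {a..b} \<Longrightarrow> (W has_real_derivative m t * L' (p t) (h t)) (at t within {a..b})"
    and "W a = 0"
  shows "\<exists>r>0. \<exists>u. (\<forall>\<epsilon>. \<bar>\<epsilon>\<bar> < r \<longrightarrow> u \<epsilon> a = 0 \<and> (\<forall>t\<in>{a..b}.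
      (u \<epsilon> has_real_derivative L (p t + \<epsilon> *\<^sub>R h t + u \<epsilon> t *\<^sub>R e) - L (p t)) (at t within {a..b}))) \<and>
    ((\<lambda>\<epsilon>. u \<epsilon> b) has_real_derivative W b / m b) (at 0)"
proof -
  have bound: "\<exists>B>0. \<forall>t\<in>{a..b}. norm (f t) \<le> B" if "continuous_on {a..b} f" for f :: "real \<Rightarrow> 'w::real_normed_vector"
    using compact_imp_bounded[OF compact_continuous_image[OF that compact_Icc]] by (auto simp: bounded_pos)
  obtain P where P: "\<And>t. t \<in> {a..b} \<Longrightarrow> norm (p t) \<le> P" using bound[OF p] by blast
  obtain B where B: "B > 0" "\<And>t. t \<in> {a..b} \<Longrightarrow> norm (h t) \<le> B" using bound[OF h] by blast
  have "continuous_on {a..b} m" using m by (rule DERIV_continuous_on)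
  then obtain Mm where Mm: "Mm > 0" "\<And>t. t \<in> {a..b} \<Longrightarrow> \<bar>m t\<bar> \<le> Mm"
    using bound[of m] unfolding real_norm_def by blast
  \<comment> \<open>This radius holds every point
    \<open>p t + (\<epsilon> *\<^sub>R h t + c *\<^sub>R e)\<close> with \<open>\<epsilon>\<close>
    and \<open>c\<close> in [-1, 1].\<close>
  define R where "R = P + (B + norm e)"
  obtain N where "N \<ge> 0" and N: "\<And>p q. p \<in> cball 0 R \<Longrightarrow> q \<in> cball 0 R \<Longrightarrow> \<bar>L p - L q\<bar> \<le> N * norm (p - q)"
    using C1_Lipschitz_on_cball[OF L L', of R] by blast
  have in_R: "p t + v \<in> cball 0 R" if "t \<in> {a..b}" "norm v \<le> B + norm e" for t v
    using P[OF that(1)] that(2) norm_triangle_ineq[of "p t" v] by (simp add: R_def)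
  have v_le: "norm (\<epsilon> *\<^sub>R h t + c *\<^sub>R e) \<le> x * B + y * norm e"
    if "t \<in> {a..b}" "\<bar>\<epsilon>\<bar> \<le> x" "\<bar>c\<bar> \<le> y" for t \<epsilon> c x y
  proof -
    have "norm (\<epsilon> *\<^sub>R h t + c *\<^sub>R e) \<le> \<bar>\<epsilon>\<bar> * norm (h t) + \<bar>c\<bar> * norm e"
      using norm_triangle_ineq[of "\<epsilon> *\<^sub>R h t" "c *\<^sub>R e"] by simp
    also have "\<dots> \<le> x * B + y * norm e"
      using B(2)[OF that(1)] that by (intro add_mono mult_mono) auto
    finally show ?thesis .
  qed
  define cl :: "real \<Rightarrow> real" where "cl = clamp (- 1) 1"
  have cl_le: "\<bar>cl c\<bar> \<le> 1" for c
    using clamp_in_interval[of "-1" "1::real" c] by (simp add: cl_def abs_le_iff)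
  have cl_id: "cl c = c" if "\<bar>c\<bar> \<le> 1" for c
    using clamp_cancel_cbox[of c "-1" "1::real"] that by (simp add: cl_def abs_le_iff)
  have cl_lip: "\<bar>cl c - cl d\<bar> \<le> \<bar>c - d\<bar>" for c d
    using dist_clamps_le_dist_args[of "-1" 1 c d] by (simp add: cl_def dist_real_def)
  have cl_cont: "continuous_on S cl" for S
    unfolding cl_def by (rule clamp_continuous_on[where f = "\<lambda>x. x"]) auto
  \<comment> \<open>The constant of \<open>Lipschitz_ivp_solution\<close> for Lipschitz constant
    \<open>N * norm e\<close> and bound \<open>N * (\<bar>\<epsilon>\<bar> * B)\<close> at zero,
    with the factor \<open>\<bar>\<epsilon>\<bar>\<close> taken out.\<close>
  define Q where "Q = 2 * exp ((2 * (N * norm e) + 1) * (b - a)) * (b - a) * (N * B)"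
  have "Q \<ge> 0" using \<open>N \<ge> 0\<close> B(1) \<open>a < b\<close> by (simp add: Q_def)
  have "\<exists>u. u a = 0 \<and> (\<forall>t\<in>{a..b}.
      (u has_real_derivative L (p t + (\<epsilon> *\<^sub>R h t + cl (u t) *\<^sub>R e)) - L (p t)) (at t within {a..b}) \<and>
      \<bar>u t\<bar> \<le> Q * \<bar>\<epsilon>\<bar>)" if \<epsilon>: "\<bar>\<epsilon>\<bar> \<le> 1" for \<epsilon>
  proof -
    have in_cball: "p t + (\<epsilon> *\<^sub>R h t + cl c *\<^sub>R e) \<in> cball 0 R" if "t \<in> {a..b}" for t c
      using in_R[OF that] v_le[OF that \<epsilon> cl_le] by simp
    have "\<exists>u. u a = 0 \<and> (\<forall>t\<in>{a..b}.
        (u has_real_derivative L (p t + (\<epsilon> *\<^sub>R h t + cl (u t) *\<^sub>R e)) - L (p t)) (at t within {a..b}) \<and>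
        \<bar>u t\<bar> \<le> 2 * exp ((2 * (N * norm e) + 1) * (b - a)) * (b - a) * (N * (\<bar>\<epsilon>\<bar> * B)))"
    proof (rule Lipschitz_ivp_solution)
      have contL: "continuous_on UNIV L"
        using L by (intro has_derivative_continuous_on) auto
      show "continuous_on ({a..b} \<times> UNIV) (\<lambda>(t, u). L (p t + (\<epsilon> *\<^sub>R h t + cl u *\<^sub>R e)) - L (p t))"
        unfolding case_prod_beta
        by (intro continuous_intros continuous_on_compose2[OF contL] continuous_on_compose2[OF p]
            continuous_on_compose2[OF h] continuous_on_compose2[OF cl_cont[of UNIV]]) auto
      fix t assume t: "t \<in> {a..b}"
      show "\<bar>L (p t + (\<epsilon> *\<^sub>R h t + cl c *\<^sub>R e)) - L (p t) - (L (p t + (\<epsilon> *\<^sub>R h t + cl d *\<^sub>R e)) - L (p t))\<bar>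
          \<le> N * norm e * \<bar>c - d\<bar>" for c d
      proof -
        have "\<bar>L (p t + (\<epsilon> *\<^sub>R h t + cl c *\<^sub>R e)) - L (p t + (\<epsilon> *\<^sub>R h t + cl d *\<^sub>R e))\<bar>
            \<le> N * norm ((cl c - cl d) *\<^sub>R e)"
          using N[OF in_cball[OF t] in_cball[OF t], of c d] by (simp add: scaleR_left_diff_distrib)
        also have "\<dots> \<le> N * (\<bar>c - d\<bar> * norm e)"
          unfolding norm_scaleR real_norm_def by (intro mult_left_mono mult_right_mono cl_lip \<open>N \<ge> 0\<close>) auto
        finally show ?thesis by (simp add: mult_ac)
      qed
      have "\<bar>L (p t + (\<epsilon> *\<^sub>R h t + cl 0 *\<^sub>R e)) - L (p t)\<bar> \<le> N * norm (\<epsilon> *\<^sub>R h t)"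
        using N[OF in_cball[OF t] in_R[OF t, of 0], of 0] cl_id[of 0] B(1) by simp
      also have "\<dots> \<le> N * (\<bar>\<epsilon>\<bar> * B)"
        unfolding norm_scaleR real_norm_def by (intro mult_left_mono B(2) t \<open>N \<ge> 0\<close>) auto
      finally show "\<bar>L (p t + (\<epsilon> *\<^sub>R h t + cl 0 *\<^sub>R e)) - L (p t)\<bar> \<le> N * (\<bar>\<epsilon>\<bar> * B)" .
    qed (use \<open>a < b\<close> \<open>N \<ge> 0\<close> B(1) in auto)
    then show ?thesis by (simp add: Q_def mult_ac)
  qed
  then have "\<exists>u. \<forall>\<epsilon>. \<bar>\<epsilon>\<bar> \<le> 1 \<longrightarrow> u \<epsilon> a = 0 \<and> (\<forall>t\<in>{a..b}.
      (u \<epsilon> has_real_derivative L (p t + (\<epsilon> *\<^sub>R h t + cl (u \<epsilon> t) *\<^sub>R e)) - L (p t)) (at t within {a..b}) \<and>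
      \<bar>u \<epsilon> t\<bar> \<le> Q * \<bar>\<epsilon>\<bar>)"
    by (intro choice) blast
  then obtain u where u: "\<And>\<epsilon>. \<bar>\<epsilon>\<bar> \<le> 1 \<Longrightarrow> u \<epsilon> a = 0 \<and> (\<forall>t\<in>{a..b}.
      (u \<epsilon> has_real_derivative L (p t + (\<epsilon> *\<^sub>R h t + cl (u \<epsilon> t) *\<^sub>R e)) - L (p t)) (at t within {a..b}) \<and>
      \<bar>u \<epsilon> t\<bar> \<le> Q * \<bar>\<epsilon>\<bar>)"
    by blast
  define r where "r = min 1 (1 / (Q + 1))"
  have "r > 0" using \<open>Q \<ge> 0\<close> by (simp add: r_def)
  have u_le: "\<bar>u \<epsilon> t\<bar> \<le> 1" and u_le_Q: "\<bar>u \<epsilon> t\<bar> \<le> Q * \<bar>\<epsilon>\<bar>" if "\<bar>\<epsilon>\<bar> < r" "t \<in> {a..b}" for \<epsilon> t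
  proof -
    show *: "\<bar>u \<epsilon> t\<bar> \<le> Q * \<bar>\<epsilon>\<bar>" using u[of \<epsilon>] that by (simp add: r_def)
    have "Q * \<bar>\<epsilon>\<bar> \<le> Q * (1 / (Q + 1))"
      using that \<open>Q \<ge> 0\<close> by (intro mult_left_mono) (auto simp: r_def)
    also have "\<dots> \<le> 1" using \<open>Q \<ge> 0\<close> by simp
    finally show "\<bar>u \<epsilon> t\<bar> \<le> 1" using * by simp
  qed
  have u': "(u \<epsilon> has_real_derivative L (p t + (\<epsilon> *\<^sub>R h t + u \<epsilon> t *\<^sub>R e)) - L (p t)) (at t within {a..b})"
    if "\<bar>\<epsilon>\<bar> < r" "t \<in> {a..b}" for \<epsilon> t
  proof -
    have "\<bar>\<epsilon>\<bar> \<le> 1" using that by (simp add: r_def)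
    then have "(u \<epsilon> has_real_derivative L (p t + (\<epsilon> *\<^sub>R h t + cl (u \<epsilon> t) *\<^sub>R e)) - L (p t)) (at t within {a..b})"
      using u that(2) by blast
    then show ?thesis using cl_id[OF u_le[OF that]] by simp
  qed
  have ua: "u \<epsilon> a = 0" if "\<bar>\<epsilon>\<bar> < r" for \<epsilon>
    using u[of \<epsilon>] that by (simp add: r_def)
  define A where "A = B + Q * norm e"
  have "A > 0" using B(1) \<open>Q \<ge> 0\<close> by (simp add: A_def add_pos_nonneg)
  \<comment> \<open>At \<open>b\<close> the difference \<open>m * u - \<epsilon> * W\<close> is of
    smaller order than \<open>\<epsilon>\<close>: the equation for \<open>m\<close> cancels the
    linear term in \<open>u\<close>, so its derivative is \<open>m\<close> times the first-order
    Taylor remainder of \<open>L\<close> at \<open>p t\<close>.\<close>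
  have estimate: "\<exists>s>0. s \<le> r \<and> (\<forall>\<epsilon>. \<bar>\<epsilon>\<bar> < s \<longrightarrow>
      \<bar>m b * u \<epsilon> b - \<epsilon> * W b\<bar> \<le> Mm * (\<bar>\<epsilon>\<bar> * A * \<delta>) * (b - a))" if "\<delta> > 0" for \<delta>
  proof -
    \<comment> \<open>Uniform continuity makes \<open>d\<close>, and hence \<open>s\<close>,
      independent of \<open>t\<close>.\<close>
    have "uniformly_continuous_on (cball 0 R) L'"
      using continuous_on_subset[OF L'] by (intro compact_uniformly_continuous) auto
    then obtain d where "d > 0" and d: "\<And>q q'. q \<in> cball 0 R \<Longrightarrow> q' \<in> cball 0 R \<Longrightarrow> dist q' q < d \<Longrightarrow>
        dist (L' q') (L' q) < \<delta>"
      using \<open>\<delta> > 0\<close> unfolding uniformly_continuous_on_def by blast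
    define s where "s = min r (d / A)"
    have "\<bar>m b * u \<epsilon> b - \<epsilon> * W b\<bar> \<le> Mm * (\<bar>\<epsilon>\<bar> * A * \<delta>) * (b - a)" if \<epsilon>: "\<bar>\<epsilon>\<bar> < s" for \<epsilon>
    proof -
      have er: "\<bar>\<epsilon>\<bar> < r" and ed: "\<bar>\<epsilon>\<bar> * A < d"
        using \<epsilon> \<open>A > 0\<close> by (auto simp: s_def field_simps)
      define v where "v t = \<epsilon> *\<^sub>R h t + u \<epsilon> t *\<^sub>R e" for t
      have "\<bar>(m b * u \<epsilon> b - \<epsilon> * W b) - (m a * u \<epsilon> a - \<epsilon> * W a)\<bar> \<le> Mm * (\<bar>\<epsilon>\<bar> * A * \<delta>) * (b - a)"
      proof (rule has_real_derivative_bound)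
        fix t assume t: "t \<in> {a..b}"
        have "((\<lambda>t. m t * u \<epsilon> t - \<epsilon> * W t) has_real_derivative
            (- (L' (p t) e * m t)) * u \<epsilon> t + (L (p t + v t) - L (p t)) * m t
              - \<epsilon> * (m t * L' (p t) (h t))) (at t within {a..b})"
          using u'[OF er t] unfolding v_def
          by (intro DERIV_diff DERIV_mult DERIV_cmult m W t)
        also have "(- (L' (p t) e * m t)) * u \<epsilon> t + (L (p t + v t) - L (p t)) * m t
              - \<epsilon> * (m t * L' (p t) (h t)) = m t * (L (p t + v t) - L (p t) - L' (p t) (v t))"
          by (simp add: v_def blinfun.add_right blinfun.scaleR_right algebra_simps)
        finally show "((\<lambda>t. m t * u \<epsilon> t - \<epsilon> * W t) has_real_derivative
            m t * (L (p t + v t) - L (p t) - L' (p t) (v t))) (at t within {a..b})" .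
        have v1: "norm (v t) \<le> B + norm e"
          using v_le[OF t, of \<epsilon> 1 "u \<epsilon> t" 1] u_le[OF er t] er by (simp add: v_def r_def)
        have v2: "norm (v t) \<le> \<bar>\<epsilon>\<bar> * A"
          using v_le[OF t order_refl u_le_Q[OF er t]] by (simp add: v_def A_def algebra_simps)
        \<comment> \<open>On \<open>S\<close> the derivative of \<open>L\<close> stays within
          \<open>\<delta>\<close> of its value at \<open>p t\<close>, and the segment from
          \<open>p t\<close> to \<open>p t + v t\<close> lies in \<open>S\<close>.\<close>
        define S where "S = {q \<in> cball 0 R. dist q (p t) < d}"
        have "norm (L (p t + v t) - L (p t) - L' (p t) (p t + v t - p t)) \<le> norm (p t + v t - p t) * \<delta>"
        proof (rule differentiable_bound_linearization[where S = S and f' = "\<lambda>q. blinfun_apply (L' q)"])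
          fix c :: real assume c: "c \<in> {0..1}"
          have cv: "norm (c *\<^sub>R v t) \<le> norm (v t)"
            using c by (simp add: mult_left_le_one_le)
          have "p t + c *\<^sub>R v t \<in> cball 0 R"
            by (rule in_R[OF t]) (use cv v1 in linarith)
          moreover have "dist (p t + c *\<^sub>R v t) (p t) < d"
            using cv v2 ed by (simp add: dist_norm)
          ultimately show "p t + c *\<^sub>R (p t + v t - p t) \<in> S"
            by (simp add: S_def)
        next
          show "(L has_derivative blinfun_apply (L' q)) (at q within S)" for q
            by (rule has_derivative_at_withinI[OF L])
        next
          show pS: "p t \<in> S" using in_R[OF t, of 0] B(1) \<open>d > 0\<close> by (auto simp: S_def)
          show "onorm (blinfun_apply (L' q) - blinfun_apply (L' (p t))) \<le> \<delta>" if "q \<in> S" for q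
          proof -
            have "norm (L' q - L' (p t)) < \<delta>" using d[of "p t" q] pS that by (simp add: S_def dist_norm)
            moreover have "blinfun_apply (L' q - L' (p t)) = blinfun_apply (L' q) - blinfun_apply (L' (p t))"
              by (rule ext) (simp add: blinfun.diff_left)
            ultimately show ?thesis by (simp add: norm_blinfun.rep_eq)
          qed
        qed
        also have "\<dots> \<le> \<bar>\<epsilon>\<bar> * A * \<delta>" using v2 \<open>\<delta> > 0\<close> by (intro mult_right_mono) auto
        finally show "\<bar>m t * (L (p t + v t) - L (p t) - L' (p t) (v t))\<bar> \<le> Mm * (\<bar>\<epsilon>\<bar> * A * \<delta>)"
          unfolding abs_mult using Mm(2)[OF t] Mm(1) by (intro mult_mono) auto
      qed (use \<open>a < b\<close> in simp)
      then show ?thesis using ua[OF er] \<open>W a = 0\<close> by simp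
    qed
    moreover have "s > 0" "s \<le> r" using \<open>r > 0\<close> \<open>d > 0\<close> \<open>A > 0\<close> by (auto simp: s_def)
    ultimately show ?thesis by blast
  qed
  have "((\<lambda>\<epsilon>. u \<epsilon> b) has_real_derivative W b / m b) (at 0)"
    unfolding DERIV_def
  proof (rule LIM_I)
    fix \<eta> :: real assume "\<eta> > 0"
    define X where "X = Mm * A * (b - a)"
    have "X > 0" using Mm(1) \<open>A > 0\<close> \<open>a < b\<close> by (simp add: X_def)
    \<comment> \<open>Chosen so that the estimate, divided by
      \<open>\<bar>\<epsilon>\<bar> * m b\<close>, becomes \<open>\<eta> / 2\<close>.\<close>
    define \<delta> where "\<delta> = \<eta> * m b / (2 * X)"
    have "\<delta> > 0" using \<open>\<eta> > 0\<close> m_pos \<open>X > 0\<close> by (simp add: \<delta>_def)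
    then obtain s where s: "s > 0" "s \<le> r" and est: "\<And>\<epsilon>. \<bar>\<epsilon>\<bar> < s \<Longrightarrow>
        \<bar>m b * u \<epsilon> b - \<epsilon> * W b\<bar> \<le> Mm * (\<bar>\<epsilon>\<bar> * A * \<delta>) * (b - a)"
      using estimate by blast
    have u0: "u 0 b = 0" using u_le_Q[of 0 b] \<open>r > 0\<close> \<open>a < b\<close> by simp
    have "\<bar>u \<epsilon> b / \<epsilon> - W b / m b\<bar> < \<eta>" if "\<epsilon> \<noteq> 0" "\<bar>\<epsilon>\<bar> < s" for \<epsilon>
    proof -
      have "\<bar>u \<epsilon> b / \<epsilon> - W b / m b\<bar> = \<bar>(m b * u \<epsilon> b - \<epsilon> * W b) / (\<epsilon> * m b)\<bar>"
        using that m_pos by (simp add: field_simps)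
      also have "\<dots> = \<bar>m b * u \<epsilon> b - \<epsilon> * W b\<bar> / (\<bar>\<epsilon>\<bar> * m b)"
        using m_pos by (simp add: abs_mult)
      also have "\<dots> \<le> Mm * (\<bar>\<epsilon>\<bar> * A * \<delta>) * (b - a) / (\<bar>\<epsilon>\<bar> * m b)"
        using m_pos by (intro divide_right_mono est that) auto
      also have "\<dots> = X * \<delta> / m b" using that m_pos by (simp add: X_def field_simps)
      also have "\<dots> = \<eta> / 2" using m_pos \<open>X > 0\<close> by (simp add: \<delta>_def field_simps)
      finally show ?thesis using \<open>\<eta> > 0\<close> by simp
    qed
    then show "\<exists>s>0. \<forall>\<epsilon>. \<epsilon> \<noteq> 0 \<and> norm (\<epsilon> - 0) < s \<longrightarrow>
        norm ((u (0 + \<epsilon>) b - u 0 b) / \<epsilon> - W b / m b) < \<eta>"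
      using s(1) u0 by (intro exI[of _ s]) auto
  qed
  then show ?thesis
    using \<open>r > 0\<close> ua u' by (intro exI[of _ r] conjI exI[of _ u]) (auto simp: add.assoc)
qed

section \<open>The Euler--Lagrange equation\<close>

text \<open>The chain rule along the line through \<open>q\<close> in direction \<open>v\<close>
  ties the total operator \<open>deriv\<close> to the Frechet derivative.\<close>

lemma partial_deriv_eq:
  assumes "(f has_derivative D) (at q)"
  shows "partial_deriv f v q = D v"
proof -
  have D: "(f has_derivative D) (at (q + 0 *\<^sub>R v))" using assms by simp
  have "((\<lambda>s. f (q + s *\<^sub>R v)) has_derivative (\<lambda>s. D (s *\<^sub>R v))) (at 0)"
    by (rule has_derivative_compose[of "\<lambda>s. q + s *\<^sub>R v" "\<lambda>s. s *\<^sub>R v" 0 UNIV f D, OF _ D])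
       (auto intro!: derivative_eq_intros)
  moreover have "(\<lambda>s. D (s *\<^sub>R v)) = (*) (D v)"
    using has_derivative_bounded_linear[OF assms] by (auto simp: linear_simps fun_eq_iff)
  ultimately have "((\<lambda>s. f (q + s *\<^sub>R v)) has_field_derivative D v) (at 0)"
    by (simp add: has_field_derivative_def)
  then show ?thesis unfolding partial_deriv_def by (rule DERIV_imp_deriv)
qed

section \<open>Integration by parts and admissible variations\<close>

text \<open>
  Repeated integration by parts is stated through an antiderivative because the derivative of
  order \<open>j\<close> of \<open>f\<close> need not be continuous.
\<close>

lemma antiderivative_by_parts:
  fixes \<eta> :: "real poly"
  assumes "a < b" and "times_differentiable a b j f"
    and "\<And>i. i < j \<Longrightarrow> poly ((pderiv ^^ i) \<eta>) a = 0 \<and> poly ((pderiv ^^ i) \<eta>) b = 0"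
  shows "\<exists>S. S a = 0 \<and> S b = 0 \<and> (\<forall>t\<in>{a..b}. (S has_real_derivative
    f t * poly ((pderiv ^^ j) \<eta>) t - (- 1) ^ j * nderiv a b j f t * poly \<eta> t) (at t within {a..b}))"
  using assms(2,3)
proof (induction j arbitrary: \<eta>)
  case 0
  then show ?case by (intro exI[of _ "\<lambda>_. 0"]) auto
next
  case (Suc j)
  have vanish: "poly ((pderiv ^^ i) (pderiv \<eta>)) a = 0 \<and> poly ((pderiv ^^ i) (pderiv \<eta>)) b = 0" if "i < j" for i
    using Suc.prems(2)[of "Suc i"] that by (simp add: funpow_swap1)
  have "times_differentiable a b j f"
    using Suc.prems(1) by (rule times_differentiable_mono) simp
  from Suc.IH[OF this vanish] obtain S where S: "S a = 0" "S b = 0" "\<And>t. t \<in> {a..b} \<Longrightarrow> (S has_real_derivative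
      f t * poly ((pderiv ^^ j) (pderiv \<eta>)) t - (- 1) ^ j * nderiv a b j f t * poly (pderiv \<eta>) t)
      (at t within {a..b})"
    by blast
  \<comment> \<open>The derivative of the added product cancels the remaining term with
    \<open>pderiv \<eta>\<close> and creates the next one, with \<open>\<eta>\<close> itself and the
    opposite sign.\<close>
  define S' where "S' t = S t + (- 1) ^ j * (nderiv a b j f t * poly \<eta> t)" for t
  have "(S' has_real_derivative
      f t * poly ((pderiv ^^ Suc j) \<eta>) t - (- 1) ^ Suc j * nderiv a b (Suc j) f t * poly \<eta> t)
      (at t within {a..b})" if t: "t \<in> {a..b}" for t
  proof -
    have "(S' has_real_derivative
        f t * poly ((pderiv ^^ j) (pderiv \<eta>)) t - (- 1) ^ j * nderiv a b j f t * poly (pderiv \<eta>) t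
        + (- 1) ^ j * (nderiv a b (Suc j) f t * poly \<eta> t + poly (pderiv \<eta>) t * nderiv a b j f t))
        (at t within {a..b})"
      unfolding S'_def[abs_def]
      by (intro DERIV_add DERIV_cmult DERIV_mult S t has_field_derivative_at_within[OF poly_DERIV]
          has_real_derivative_nderiv[OF \<open>a < b\<close> Suc.prems(1)]) simp
    then show ?thesis by (simp add: algebra_simps funpow_swap1)
  qed
  moreover have "S' a = 0" "S' b = 0"
    using S(1,2) Suc.prems(2)[of 0] by (simp_all add: S'_def)
  ultimately show ?case by blast
qed

text \<open>Brings the perturbed jet into the affine form that \<open>first_variation\<close> works
  with: a multiple of a fixed direction plus a scalar multiple of the unit vector for
  \<open>z\<close>.\<close>

lemma jet_variation:
  fixes idx :: "'m::finite \<Rightarrow> nat" and \<eta> :: "real poly"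
  assumes y: "\<And>k. k \<le> n \<Longrightarrow> nderiv a b k y t = nderiv a b k x t + \<epsilon> * poly ((pderiv ^^ k) \<eta>) t"
    and idx: "\<And>i. idx i \<le> n"
  shows "jet idx a b y w t = jet idx a b x z t
    + \<epsilon> *\<^sub>R (0, (\<chi> i. poly ((pderiv ^^ idx i) \<eta>) t), 0) + (w t - z t) *\<^sub>R (0, 0, 1)"
  using idx by (simp add: jet_def vec_eq_iff y)

text \<open>Turns a solution \<open>u\<close> of the increment equation into a competitor:
  \<open>z + u\<close> solves the perturbed problem, and uniqueness shows that the solution picked
  by \<open>z_of\<close> has the same value at \<open>b\<close>.\<close>

lemma admissible_variation:
  fixes idx :: "'m::finite \<Rightarrow> nat" and \<eta> :: "real poly" and L :: "'m lagrangian"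
  assumes "n \<ge> 1" "a < b" and idx: "\<And>i. idx i \<le> n"
    and L: "\<And>q. (L has_derivative blinfun_apply (L' q)) (at q)" "continuous_on UNIV L'"
    and x: "admissible n idx L a b \<gamma> \<alpha> \<beta> x"
    and z: "solves_ivp idx L a b \<gamma> x z"
    and \<eta>: "\<And>i. i < n \<Longrightarrow> poly ((pderiv ^^ i) \<eta>) a = 0 \<and> poly ((pderiv ^^ i) \<eta>) b = 0"
    and "u a = 0" and u: "\<And>t. t \<in> {a..b} \<Longrightarrow> (u has_real_derivative
      L (jet idx a b x z t + \<epsilon> *\<^sub>R (0, (\<chi> i. poly ((pderiv ^^ idx i) \<eta>) t), 0) + u t *\<^sub>R (0, 0, 1))
        - L (jet idx a b x z t)) (at t within {a..b})"
    and cont: "continuous_on {a..b} (jet idx a b x z)"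
  shows "admissible n idx L a b \<gamma> \<alpha> \<beta> (\<lambda>t. x t + \<epsilon> * poly \<eta> t)"
    and "z_of idx L a b \<gamma> (\<lambda>t. x t + \<epsilon> * poly \<eta> t) b = z b + u b"
proof -
  define y where "y = (\<lambda>t. x t + \<epsilon> * poly \<eta> t)"
  define Y where "Y k t = nderiv a b k x t + \<epsilon> * poly ((pderiv ^^ k) \<eta>) t" for k t
  have tx: "times_differentiable a b (2 * n) x" "continuous_on {a..b} (nderiv a b (2 * n) x)"
    using x by (auto simp: admissible_def times_continuously_differentiable_def)
  have Y0: "y t = Y 0 t" for t by (simp add: y_def Y_def)
  have Y': "(Y k has_real_derivative Y (Suc k) t) (at t within {a..b})" if "k < 2 * n" "t \<in> {a..b}" for k t
  proof -
    have "(poly ((pderiv ^^ k) \<eta>) has_real_derivative poly ((pderiv ^^ Suc k) \<eta>) t) (at t within {a..b})"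
      using poly_DERIV[of "(pderiv ^^ k) \<eta>" t] by (simp add: has_field_derivative_at_within)
    then show ?thesis
      unfolding Y_def[abs_def]
      by (intro DERIV_add DERIV_cmult has_real_derivative_nderiv[OF \<open>a < b\<close> tx(1) that])
  qed
  have nY: "nderiv a b k y t = Y k t" if "k \<le> 2 * n" "t \<in> {a..b}" for k t
    by (rule nderiv_eqI[OF \<open>a < b\<close> Y0 Y' that])
  have "times_differentiable a b (2 * n) y"
    by (rule times_differentiableI[OF \<open>a < b\<close> Y0 Y'])
  moreover have "continuous_on {a..b} (nderiv a b (2 * n) y)"
    by (rule continuous_on_eq[of _ "Y (2 * n)"])
       (use nY in \<open>auto simp: Y_def[abs_def] intro!: continuous_intros tx(2)\<close>)
  ultimately have ty: "times_continuously_differentiable a b (2 * n) y"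
    by (simp add: times_continuously_differentiable_def)
  have jet: "jet idx a b y w t = jet idx a b x z t
    + \<epsilon> *\<^sub>R (0, (\<chi> i. poly ((pderiv ^^ idx i) \<eta>) t), 0) + (w t - z t) *\<^sub>R (0, 0, 1)"
    if "t \<in> {a..b}" for t w
    by (rule jet_variation[OF _ idx]) (use nY that in \<open>simp add: Y_def\<close>)
  have sol: "solves_ivp idx L a b \<gamma> y (\<lambda>t. z t + u t)"
    unfolding solves_ivp_def
  proof (intro conjI ballI)
    show "z a + u a = \<gamma>" using z \<open>u a = 0\<close> by (simp add: solves_ivp_def)
    fix t assume t: "t \<in> {a..b}"
    have "(z has_real_derivative L (jet idx a b x z t)) (at t within {a..b})"
      using z t by (simp add: solves_ivp_def)
    from DERIV_add[OF this u[OF t]] jet[OF t, of "\<lambda>t. z t + u t"]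
    show "((\<lambda>t. z t + u t) has_real_derivative L (jet idx a b y (\<lambda>t. z t + u t) t)) (at t within {a..b})"
      by simp
  qed
  have bdy: "nderiv a b i y a = \<alpha> i \<and> nderiv a b i y b = \<beta> i" if "i < n" for i
    using x \<eta>[OF that] nY[of i] \<open>a < b\<close> that by (simp add: admissible_def Y_def)
  show "admissible n idx L a b \<gamma> \<alpha> \<beta> (\<lambda>t. x t + \<epsilon> * poly \<eta> t)"
    using ty sol bdy unfolding admissible_def y_def by blast
  define w where "w = z_of idx L a b \<gamma> y"
  have w: "solves_ivp idx L a b \<gamma> y w"
    unfolding w_def z_of_def by (rule someI[of "solves_ivp idx L a b \<gamma> y", OF sol])
  \<comment> \<open>The perturbed jet with its last coordinate set to zero; in terms of
    \<open>P\<close>, both \<open>w\<close> and \<open>z + u\<close> solve the same scalar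
    equation.\<close>
  define P where "P t = jet idx a b x z t
    + \<epsilon> *\<^sub>R (0, (\<chi> i. poly ((pderiv ^^ idx i) \<eta>) t), 0) - z t *\<^sub>R (0, 0, 1)" for t
  have jetP: "jet idx a b y v t = P t + v t *\<^sub>R (0, 0, 1)" if "t \<in> {a..b}" for t v
    using jet[OF that, of v] by (simp add: P_def scaleR_left_diff_distrib)
  have contz: "continuous_on {a..b} z"
    using z by (auto simp: solves_ivp_def intro: DERIV_continuous_on)
  have "w b = z b + u b"
  proof (rule ivp_unique[OF \<open>a < b\<close> L, of P w "(0, 0, 1)"])
    show "continuous_on {a..b} P"
      unfolding P_def[abs_def]
      by (intro continuous_intros cont contz continuous_on_Pair continuous_on_vec_lambda)
    show "(w has_real_derivative L (P t + w t *\<^sub>R (0, 0, 1))) (at t within {a..b})" if "t \<in> {a..b}" for t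
      using w that unfolding solves_ivp_def jetP[OF that, of w, symmetric] by blast
    show "((\<lambda>t. z t + u t) has_real_derivative L (P t + (z t + u t) *\<^sub>R (0, 0, 1))) (at t within {a..b})"
      if "t \<in> {a..b}" for t
      using sol that unfolding solves_ivp_def jetP[OF that, of "\<lambda>t. z t + u t", symmetric] by blast
    show "w a = z a + u a" using w sol by (simp add: solves_ivp_def)
  qed
  then show "z_of idx L a b \<gamma> (\<lambda>t. x t + \<epsilon> * poly \<eta> t) b = z b + u b"
    by (simp add: w_def y_def)
qed

theorem theorem4:
  fixes n :: nat and a b \<gamma> :: real and \<alpha> \<beta> :: "nat \<Rightarrow> real"
    and idx :: "'m::finite \<Rightarrow> nat"
    and L :: "real \<times> (real ^ 'm) \<times> real \<Rightarrow> real"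
    and x :: "real \<Rightarrow> real"
  assumes "n \<ge> 1" and "a < b"
    and "bij_betw idx UNIV {0..n}"
    and "C1 L"
    and "regular_along_admissible n idx L a b \<gamma> \<alpha> \<beta>"
    and "extremizer n idx L a b \<gamma> \<alpha> \<beta> x"
  shows "euler_lagrange n idx L a b x (z_of idx L a b \<gamma> x)"
proof -
  define z where "z = z_of idx L a b \<gamma> x"
  define p where "p = jet idx a b x z"
  define e :: "real \<times> (real ^ 'm) \<times> real" where "e = (0, 0, 1)"
  define f where "f j t = dL_dx idx L j (p t)" for j t
  define g where "g t = dL_dz L (p t)" for t
  define m where "m = multiplier idx L a b x z"
  define \<phi> where "\<phi> j t = m t * f j t" for j t
  have adm: "admissible n idx L a b \<gamma> \<alpha> \<beta> x"
    using assms(6) by (simp add: extremizer_def)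
  have z: "solves_ivp idx L a b \<gamma> x z"
    using adm unfolding z_def z_of_def admissible_def by (simp add: some_eq_ex)
  have idx: "idx i \<le> n" for i
    using bij_betwE[OF assms(3)] by auto
  obtain L' where L: "\<And>q. (L has_derivative blinfun_apply (L' q)) (at q)" and L': "continuous_on UNIV L'"
    using assms(4) unfolding C1_def by blast
  have gL: "g t = L' (p t) e" for t
    by (simp add: g_def dL_dz_def e_def partial_deriv_eq[OF L])
  have fL: "f j t = L' (p t) (0, axis (inv idx j) 1, 0)" for j t
    by (simp add: f_def dL_dx_def partial_deriv_eq[OF L])
  have tx: "times_differentiable a b (2 * n) x"
    using adm by (simp add: admissible_def times_continuously_differentiable_def)
  have contz: "continuous_on {a..b} z"
    using z by (auto simp: solves_ivp_def intro: DERIV_continuous_on)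
  have contp: "continuous_on {a..b} p"
    unfolding p_def jet_def[abs_def]
  proof (intro continuous_intros contz continuous_on_vec_lambda)
    \<comment> \<open>Here \<open>n \<ge> 1\<close> gives \<open>idx i < 2 * n\<close>, so the
      derivatives in the jet are differentiable, hence continuous.\<close>
    show "continuous_on {a..b} (nderiv a b (idx i) x)" for i
      using idx[of i] \<open>n \<ge> 1\<close> by (intro continuous_on_nderiv[OF tx]) simp
  qed
  have contL': "continuous_on {a..b} (\<lambda>t. L' (p t))"
    by (rule continuous_on_compose2[OF L' contp]) simp
  have contg: "continuous_on {a..b} g"
    unfolding gL[abs_def] by (intro continuous_intros contL')
  have m_pos: "m t > 0" for t by (simp add: m_def multiplier_def)
  \<comment> \<open>This linear equation makes \<open>m\<close> an integrating factor for
    \<open>first_variation\<close> and passes the smoothness of \<open>g\<close> on to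
    \<open>m\<close>.\<close>
  have m': "(m has_real_derivative - (g t * m t)) (at t within {a..b})" if "t \<in> {a..b}" for t
    unfolding m_def multiplier_def[abs_def] g_def[symmetric] p_def[symmetric]
    by (auto intro!: derivative_eq_intros integral_has_real_derivative[OF contg that])
  have tf: "times_differentiable a b n (f j)" if "j \<le> n" for j
    using assms(5) adm that
    unfolding regular_along_admissible_def f_def[abs_def] p_def z_def by auto
  have tg: "times_differentiable a b n g"
    using assms(5) adm
    unfolding regular_along_admissible_def g_def[abs_def] p_def z_def by auto
  have t\<phi>: "times_differentiable a b n (\<phi> j)" if "j \<le> n" for j
    unfolding \<phi>_def[abs_def]
    by (intro times_differentiable_mult times_differentiable_linear_ode[OF _ m'] tf tg that \<open>a < b\<close>)
  have cont\<phi>: "continuous_on {a..b} (\<phi> j)" if "j \<le> n" for j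
    using continuous_on_nderiv[OF t\<phi>[OF that], of 0] \<open>n \<ge> 1\<close> by simp

  define E where "E t = (\<Sum>j=0..n. (- 1) ^ j * nderiv a b j (\<phi> j) t)" for t
  \<comment> \<open>An antiderivative of \<open>E\<close>: the continuous term
    \<open>\<phi> 0\<close> is integrated, while for \<open>j \<ge> 1\<close> the derivative of
    order \<open>j - 1\<close> serves.\<close>
  define G where "G t = integral {a..t} (\<phi> 0) + (\<Sum>j=Suc 0..n. (- 1) ^ j * nderiv a b (j - 1) (\<phi> j) t)" for t
  have G: "(G has_real_derivative E t) (at t within {a..b})" if t: "t \<in> {a..b}" for t
  proof -
    have "((\<lambda>t. \<Sum>j=Suc 0..n. (- 1) ^ j * nderiv a b (j - 1) (\<phi> j) t) has_real_derivative
        (\<Sum>j=Suc 0..n. (- 1) ^ j * nderiv a b j (\<phi> j) t)) (at t within {a..b})"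
    proof (intro DERIV_sum DERIV_cmult)
      fix j assume "j \<in> {Suc 0..n}"
      then show "(nderiv a b (j - 1) (\<phi> j) has_real_derivative nderiv a b j (\<phi> j) t) (at t within {a..b})"
        using has_real_derivative_nderiv[OF \<open>a < b\<close> t\<phi>[of j] _ t, of "j - 1"] by auto
    qed
    from DERIV_add[OF integral_has_real_derivative[OF cont\<phi>[of 0] t] this]
    show ?thesis
      unfolding G_def[abs_def] E_def by (simp add: sum.atLeast_Suc_atMost)
  qed

  have orth: "((\<lambda>t. E t * poly \<eta> t) has_integral 0) {a..b}"
    if \<eta>: "\<And>i. i < n \<Longrightarrow> poly ((pderiv ^^ i) \<eta>) a = 0 \<and> poly ((pderiv ^^ i) \<eta>) b = 0"
    for \<eta> :: "real poly"
  proof -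
    define h :: "real \<Rightarrow> real \<times> (real ^ 'm) \<times> real"
      where "h t = (0, (\<chi> i. poly ((pderiv ^^ idx i) \<eta>) t), 0)" for t
    define W where "W t = integral {a..t} (\<lambda>s. m s * L' (p s) (h s))" for t
    have conth: "continuous_on {a..b} h"
      unfolding h_def[abs_def] by (intro continuous_intros continuous_on_vec_lambda)
    have W': "(W has_real_derivative m t * L' (p t) (h t)) (at t within {a..b})" if "t \<in> {a..b}" for t
    proof -
      have "continuous_on {a..b} m" using m' by (rule DERIV_continuous_on)
      then have "continuous_on {a..b} (\<lambda>s. m s * L' (p s) (h s))"
        by (intro continuous_intros contL' conth)
      from integral_has_real_derivative[OF this that] show ?thesis unfolding W_def[abs_def] .
    qed
    have "W a = 0" by (simp add: W_def)
    obtain r u where "r > 0"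
      and u: "\<And>\<epsilon>. \<bar>\<epsilon>\<bar> < r \<Longrightarrow> u \<epsilon> a = 0"
        "\<And>\<epsilon> t. \<bar>\<epsilon>\<bar> < r \<Longrightarrow> t \<in> {a..b} \<Longrightarrow>
          (u \<epsilon> has_real_derivative L (p t + \<epsilon> *\<^sub>R h t + u \<epsilon> t *\<^sub>R e) - L (p t)) (at t within {a..b})"
      and du: "((\<lambda>\<epsilon>. u \<epsilon> b) has_real_derivative W b / m b) (at 0)"
      using first_variation[OF \<open>a < b\<close> L L' contp conth m'[unfolded gL] m_pos W' \<open>W a = 0\<close>]
      by blast
    note var = admissible_variation[OF assms(1,2) idx L L' adm z \<eta> u(1)
        u(2)[unfolded p_def h_def e_def] contp[unfolded p_def]]
    \<comment> \<open>For \<open>\<epsilon> = 0\<close> the perturbed trajectory is \<open>x\<close>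
      itself.\<close>
    have u0: "u 0 b = 0"
      using var(2)[of 0] \<open>r > 0\<close> by (simp add: z_def)
    \<comment> \<open>Global extremality among the competitors makes zero a local extremum of
      \<open>u \<epsilon> b\<close> in \<open>\<epsilon>\<close>; a minimum and a maximum both force
      the derivative \<open>W b / m b\<close> to vanish.\<close>
    have "(\<forall>\<epsilon>. \<bar>0 - \<epsilon>\<bar> < r \<longrightarrow> u 0 b \<le> u \<epsilon> b) \<or> (\<forall>\<epsilon>. \<bar>0 - \<epsilon>\<bar> < r \<longrightarrow> u \<epsilon> b \<le> u 0 b)"
      using assms(6) var unfolding extremizer_def u0 z_def[symmetric] by fastforce
    then have "W b / m b = 0"
      using DERIV_local_min[OF du \<open>r > 0\<close>] DERIV_local_max[OF du \<open>r > 0\<close>] by blast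
    then have "W b = 0" using m_pos[of b] by simp
    \<comment> \<open>Expanding \<open>h t\<close> in unit vectors gives a sum over coordinates,
      which the bijection \<open>idx\<close> turns into a sum over orders of derivatives.\<close>
    have mLh: "m t * L' (p t) (h t) = (\<Sum>j=0..n. \<phi> j t * poly ((pderiv ^^ j) \<eta>) t)" for t
    proof -
      have "h t = (\<Sum>i\<in>UNIV. poly ((pderiv ^^ idx i) \<eta>) t *\<^sub>R (0, axis i 1, 0))"
        by (simp add: h_def sum_prod vec_eq_iff axis_def if_distrib cong: if_cong)
      then have "L' (p t) (h t) = (\<Sum>i\<in>UNIV. poly ((pderiv ^^ idx i) \<eta>) t * f (idx i) t)"
        using bij_betw_imp_inj_on[OF assms(3)]
        by (simp add: blinfun.sum_right blinfun.scaleR_right fL del: scaleR_Pair)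
      also have "\<dots> = (\<Sum>j=0..n. poly ((pderiv ^^ j) \<eta>) t * f j t)"
        by (rule sum.reindex_bij_betw[OF assms(3)])
      finally show ?thesis by (simp add: \<phi>_def sum_distrib_left mult_ac)
    qed
    have "\<exists>S. S a = 0 \<and> S b = 0 \<and> (\<forall>t\<in>{a..b}. (S has_real_derivative
        \<phi> j t * poly ((pderiv ^^ j) \<eta>) t - (- 1) ^ j * nderiv a b j (\<phi> j) t * poly \<eta> t) (at t within {a..b}))"
      if "j \<le> n" for j
      using that \<eta>
      by (intro antiderivative_by_parts \<open>a < b\<close> times_differentiable_mono[OF t\<phi>[OF that] that]) auto
    then obtain S where S: "\<And>j. j \<le> n \<Longrightarrow> S j a = 0 \<and> S j b = 0 \<and> (\<forall>t\<in>{a..b}. (S j has_real_derivative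
        \<phi> j t * poly ((pderiv ^^ j) \<eta>) t - (- 1) ^ j * nderiv a b j (\<phi> j) t * poly \<eta> t) (at t within {a..b}))"
      by metis
    \<comment> \<open>Removing the integration-by-parts corrections \<open>S j\<close> from
      \<open>W\<close> leaves an antiderivative of \<open>E * \<eta>\<close> that is zero at both
      end points.\<close>
    have "((\<lambda>t. W t - (\<Sum>j=0..n. S j t)) has_real_derivative E t * poly \<eta> t) (at t within {a..b})"
      if t: "t \<in> {a..b}" for t
    proof -
      have "((\<lambda>t. W t - (\<Sum>j=0..n. S j t)) has_real_derivative m t * L' (p t) (h t) -
          (\<Sum>j=0..n. \<phi> j t * poly ((pderiv ^^ j) \<eta>) t - (- 1) ^ j * nderiv a b j (\<phi> j) t * poly \<eta> t))
          (at t within {a..b})"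
        using S t by (intro DERIV_diff DERIV_sum W') auto
      then show ?thesis
        unfolding mLh by (simp add: E_def sum_subtractf sum_distrib_right)
    qed
    then have "((\<lambda>t. E t * poly \<eta> t) has_integral
        (W b - (\<Sum>j=0..n. S j b)) - (W a - (\<Sum>j=0..n. S j a))) {a..b}"
      using \<open>a < b\<close>
      by (intro fundamental_theorem_of_calculus)
         (auto simp flip: has_real_derivative_iff_has_vector_derivative)
    then show ?thesis using S \<open>W a = 0\<close> \<open>W b = 0\<close> by simp
  qed
  have "E t = 0" if "t \<in> {a..b}" for t
    using du_Bois_Reymond[OF \<open>a < b\<close> G orth that] .
  moreover have "times_differentiable a b j (\<phi> j)" if "j \<le> n" for j
    by (rule times_differentiable_mono[OF t\<phi>[OF that] that])
  ultimately show ?thesis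
    unfolding euler_lagrange_def E_def \<phi>_def[abs_def] f_def m_def p_def z_def by auto
qed

end
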